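(* Let $N=\dim H=1$. The group $G_-'=G_-/\{\exp(az^{-1}):a\in\mathbb C\}$ acts freely on the set $GW_0$.
   Context: Here $H=\mathbb C$ with $(x,y)=xy$ (so $g_{1,1}=1$), $\mathbf 1=1$. Variables $t_0,t_1,\dots$; $q_i=t_i-\delta_{i,1}$; $\partial_i=\partial/\partial t_i=\partial/\partial q_i$; functions $F$ are formal power series in the $t_i$. $GW_0$ is the set of all $F$ satisfying (DE) $\sum_{i\ge0}q_i\partial_iF=2F$; (SE) $\sum_{i\ge0}q_{i+1}\partial_iF=-\frac12q_0^2$; (TRR) $\partial_{k+1}\partial_l\partial_mF=\partial_k\partial_0F\cdot\partial_0\partial_l\partial_mF$ for all $k,l,m\ge0$. $G_-$ is the group of series $S(z)=1+\sum_{i>0}S_iz^{-i}$ with $S(-z)S(z)=1$; for $N=1$ it is the abelian group $G_-=\{\exp(\sum_{i\ge1}a_iz^{-2i+1}):a_i\in\mathbb C\}$. The subgroup $\{\exp(az^{-1})\}$ acts trivially on $GW_0$ because of the string equation, so the action factors through $G_-'$, whose elements are represented uniquely by $S=\exp(\sum_{i\ge1}a_{2i+1}z^{-2i-1})$. Such $S$ acts by $$(\widehat SF)(\mathbf q)=F\big([S^{-1}(z)\mathbf q(z)]_+\big)+\frac12\sum_{k,l\ge0}W_{k,l}q_kq_l,\qquad \sum_{k,l\ge0}\frac{W_{k,l}}{z^kw^l}=\frac{S^{-1}(w)S^{-1}(z)-1}{z^{-1}+w^{-1}},$$ where $\mathbf q(z)=\sum_{n\ge0}q_nz^n$, $[\cdot]_+$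 is the part with non-negative powers of $z$, and $F(\mathbf q(z))$ means $F(q_0,q_1,\dots)$. (Equivalently, the graph of $d(\widehat SF)$ is the image under $S(z)$ of the graph of $dF$ in $\mathbb C((z^{-1}))$ with coordinates $\sum_nq_nz^n+\sum_np_n(-z)^{-n-1}$, $p_n=\partial_nF$.) *)

theory Defs
  imports
    "HOL-Library.Multiset"
    "HOL-Library.Groups_Big_Fun"
    "HOL-Computational_Algebra.Formal_Power_Series"
    "HOL-Algebra.Group_Action"
begin

section \<open>Formal power series in the variables \<open>t\<^sub>0, t\<^sub>1, \<dots>\<close>\<close>

text \<open>
  A monomial \<open>t\<^bsub>i\<^sub>1\<^esub> \<cdots> t\<^bsub>i\<^sub>d\<^esub>\<close> is encoded as the multiset \<open>{#i\<^sub>1, \<dots>, i\<^sub>d#}\<close> of the indices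
  of its variables, and a formal power series is an arbitrary assignment of coefficients to
  monomials.
\<close>

typedef ips = "UNIV :: (nat multiset \<Rightarrow> complex) set"
  morphisms ips_nth Abs_ips ..

setup_lifting type_definition_ips

lemma ips_eqI: "(\<And>M. ips_nth F M = ips_nth G M) \<Longrightarrow> F = G"
  by (simp add: ips_nth_inject[symmetric] fun_eq_iff)

lemma finite_mset_sub: "finite {A. A \<subseteq># (M :: 'a multiset)}"
proof (induction M)
  case (add x M)
  have "{A. A \<subseteq># add_mset x M} \<subseteq> {A. A \<subseteq># M} \<union> add_mset x ` {A. A \<subseteq># M}"
  proof
    fix A assume "A \<in> {A. A \<subseteq># add_mset x M}"
    hence A: "A \<subseteq># add_mset x M" by simp
    show "A \<in> {A. A \<subseteq># M} \<union> add_mset x ` {A. A \<subseteq># M}"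
    proof (cases "x \<in># A")
      case True
      then obtain B where "A = add_mset x B" by (metis insert_DiffM)
      thus ?thesis using A by auto
    next
      case False
      thus ?thesis using A
        by (metis CollectI UnI1 diff_single_trivial subset_eq_diff_conv add_mset_add_single)
    qed
  qed
  thus ?case using add by (meson finite_UnI finite_imageI finite_subset)
qed simp

lemma finite_mset_splits: "finite {(A, B). A + B = (M :: 'a multiset)}"
proof (rule finite_subset)
  show "{(A, B). A + B = M} \<subseteq> (\<lambda>A. (A, M - A)) ` {A. A \<subseteq># M}" by force
qed (simp add: finite_mset_sub)

instantiation ips :: comm_ring_1
begin

lift_definition zero_ips :: ips is "\<lambda>M. 0" .
lift_definition one_ips :: ips is "\<lambda>M. if M = {#} then 1 else 0" .
lift_definition plus_ips :: "ips \<Rightarrow> ips \<Rightarrow> ips" is "\<lambda>F G M. F M + G M" .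
lift_definition minus_ips :: "ips \<Rightarrow> ips \<Rightarrow> ips" is "\<lambda>F G M. F M - G M" .
lift_definition uminus_ips :: "ips \<Rightarrow> ips" is "\<lambda>F M. - F M" .
lift_definition times_ips :: "ips \<Rightarrow> ips \<Rightarrow> ips" is
  "\<lambda>F G M. \<Sum>(A, B) \<in> {(A, B). A + B = M}. F A * G B" .

instance
proof
  fix a b c :: ips
  show "a + b + c = a + (b + c)" "a + b = b + a" "0 + a = a" "- a + a = 0" "a - b = a + - b"
    by (transfer; simp add: fun_eq_iff)+
  show "(0 :: ips) \<noteq> 1" by transfer (auto simp: fun_eq_iff)
  show "(a + b) * c = a * c + b * c"
    by transfer (simp add: fun_eq_iff algebra_simps case_prod_unfold sum.distrib)
  show "a * b = b * a"
  proof (transfer, rule ext)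
    fix f g :: "nat multiset \<Rightarrow> complex" and M
    show "(\<Sum>(A, B) \<in> {(A, B). A + B = M}. f A * g B) = (\<Sum>(A, B) \<in> {(A, B). A + B = M}. g A * f B)"
      by (rule sum.reindex_bij_witness[of _ prod.swap prod.swap])
         (auto simp: mult.commute add.commute)
  qed
  show "1 * a = a"
  proof (transfer, rule ext)
    fix f :: "nat multiset \<Rightarrow> complex" and M
    have "(\<Sum>(A, B) \<in> {(A, B). A + B = M}. (if A = {#} then 1 else 0) * f B)
        = (\<Sum>(A, B) \<in> {({#} :: nat multiset, M)}. (if A = {#} then 1 else 0) * f B)"
      by (rule sum.mono_neutral_right) (auto simp: finite_mset_splits split: if_splits)
    thus "(\<Sum>(A, B) \<in> {(A, B). A + B = M}. (if A = {#} then 1 else 0) * f B) = f M" by simp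
  qed
  show "a * b * c = a * (b * c)"
  proof (transfer, rule ext)
    fix f g h :: "nat multiset \<Rightarrow> complex" and M
    let ?S = "\<lambda>M :: nat multiset. {(A, B). A + B = M}"
    have "(\<Sum>(A, B) \<in> ?S M. (\<Sum>(A', B') \<in> ?S A. f A' * g B') * h B)
        = (\<Sum>x \<in> ?S M. \<Sum>y \<in> ?S (fst x). f (fst y) * g (snd y) * h (snd x))"
      by (simp add: case_prod_unfold sum_distrib_right)
    also have "\<dots> = (\<Sum>(x, y) \<in> Sigma (?S M) (\<lambda>x. ?S (fst x)). f (fst y) * g (snd y) * h (snd x))"
      by (rule sum.Sigma) (auto simp: finite_mset_splits)
    also have "\<dots> = (\<Sum>(x, y) \<in> Sigma (?S M) (\<lambda>x. ?S (snd x)). f (fst x) * (g (fst y) * h (snd y)))"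
      by (rule sum.reindex_bij_witness[of _
            "\<lambda>((A, _), (B, C)). ((A + B, C), (A, B))" "\<lambda>((_, C), (A, B)). ((A, B + C), (B, C))"])
         (auto simp: ac_simps)
    also have "\<dots> = (\<Sum>x \<in> ?S M. \<Sum>y \<in> ?S (snd x). f (fst x) * (g (fst y) * h (snd y)))"
      by (rule sum.Sigma[symmetric]) (auto simp: finite_mset_splits)
    also have "\<dots> = (\<Sum>(A, B) \<in> ?S M. f A * (\<Sum>(A', B') \<in> ?S B. g A' * h B'))"
      by (simp add: case_prod_unfold sum_distrib_left)
    finally show "(\<Sum>(A, B) \<in> ?S M. (\<Sum>(A', B') \<in> ?S A. f A' * g B') * h B)
        = (\<Sum>(A, B) \<in> ?S M. f A * (\<Sum>(A', B') \<in> ?S B. g A' * h B'))" .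
  qed
qed

end

lift_definition ips_const :: "complex \<Rightarrow> ips" is "\<lambda>c M. if M = {#} then c else 0" .

lift_definition ips_var :: "nat \<Rightarrow> ips" is "\<lambda>i M. if M = {#i#} then 1 else 0" .

text \<open>Partial derivative with respect to \<open>t\<^sub>i\<close>.\<close>

lift_definition ips_deriv :: "nat \<Rightarrow> ips \<Rightarrow> ips" (\<open>\<partial>\<close>) is
  "\<lambda>i F M. of_nat (Suc (count M i)) * F (add_mset i M)" .

text \<open>
  Infinite sums are formed coefficientwise. They are only meaningful for locally finite families
  (each monomial occurs in finitely many members), since a coefficient to which infinitely many
  members contribute is set to \<open>0\<close> by \<^const>\<open>Sum_any\<close>. The families
  below are locally finite; for \<open>S_hat\<close> this needs \<open>S\<close> to be reduced.
\<close>

lift_definition ips_sum :: "('i \<Rightarrow> ips) \<Rightarrow> ips" is "\<lambda>f M. Sum_any (\<lambda>i. f i M)" .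

text \<open>The series \<open>F(y\<^sub>0, y\<^sub>1, \<dots>)\<close> obtained by substituting \<open>t\<^sub>i := y\<^sub>i\<close>.\<close>

definition ips_subst :: "ips \<Rightarrow> (nat \<Rightarrow> ips) \<Rightarrow> ips" where
  "ips_subst F y = ips_sum (\<lambda>M. ips_const (ips_nth F M) * prod_mset (image_mset y M))"


section \<open>The set \<open>GW\<^sub>0\<close>\<close>

text \<open>The dilaton-shifted coordinates \<open>q\<^sub>i = t\<^sub>i - \<delta>\<^bsub>i,1\<^esub>\<close>.\<close>

definition q :: "nat \<Rightarrow> ips" where
  "q i = ips_var i - (if i = 1 then 1 else 0)"

definition DE :: "ips \<Rightarrow> bool" where
  "DE F \<longleftrightarrow> ips_sum (\<lambda>i. q i * \<partial> i F) = 2 * F"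

definition SE :: "ips \<Rightarrow> bool" where
  "SE F \<longleftrightarrow> ips_sum (\<lambda>i. q (i + 1) * \<partial> i F) = - (ips_const (1/2) * (q 0)\<^sup>2)"

definition TRR :: "ips \<Rightarrow> bool" where
  "TRR F \<longleftrightarrow> (\<forall>k l m. \<partial> (k + 1) (\<partial> l (\<partial> m F)) = \<partial> k (\<partial> 0 F) * \<partial> 0 (\<partial> l (\<partial> m F)))"

definition GW0 :: "ips set" where
  "GW0 = {F. DE F \<and> SE F \<and> TRR F}"


section \<open>The groups \<open>G\<^sub>-\<close> and \<open>G\<^sub>-'\<close>\<close>

text \<open>
  A series \<open>S(z) = \<Sum>\<^sub>i S\<^sub>i z\<^bsup>-i\<^esup>\<close> is encoded as a formal power series in \<open>x = z\<^bsup>-1\<^esup>\<close>.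
\<close>

definition Gminus :: "complex fps monoid" where
  "Gminus = \<lparr>carrier = {S. fps_nth S 0 = 1 \<and> (S oo (- fps_X)) * S = 1}, mult = (*), one = 1\<rparr>"

definition Gminus_string :: "complex fps set" where
  "Gminus_string = range fps_exp"

definition Gminus' :: "complex fps set monoid" where
  "Gminus' = Gminus Mod Gminus_string"

text \<open>The representatives \<open>exp (\<Sum>\<^bsub>i\<ge>1\<^esub> a\<^bsub>2i+1\<^esub> z\<^bsup>-2i-1\<^esup>)\<close> of the elements of \<open>G\<^sub>-'\<close>.\<close>

definition reduced :: "complex fps \<Rightarrow> bool" where
  "reduced S \<longleftrightarrow>
     (\<exists>a. (\<forall>n. fps_nth a n \<noteq> 0 \<longrightarrow> odd n \<and> n \<ge> 3) \<and> S = fps_exp 1 oo a)"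

definition rep :: "complex fps set \<Rightarrow> complex fps" where
  "rep C = (THE S. S \<in> C \<and> reduced S)"


section \<open>The action\<close>

text \<open>
  \<open>S(z)\<close> and \<open>S(w)\<close> as power series in \<open>w\<^bsup>-1\<^esup>\<close> (the outer \<^const>\<open>fps_X\<close>) with coefficients
  power series in \<open>z\<^bsup>-1\<^esup>\<close> (the inner \<^const>\<open>fps_X\<close>).
\<close>

definition in_z :: "complex fps \<Rightarrow> complex fps fps" where
  "in_z S = fps_const S"

definition in_w :: "complex fps \<Rightarrow> complex fps fps" where
  "in_w S = Abs_fps (\<lambda>l. fps_const (fps_nth S l))"

text \<open>The quotient \<open>(S\<^bsup>-1\<^esup>(w) S\<^bsup>-1\<^esup>(z) - 1) / (z\<^bsup>-1\<^esup> + w\<^bsup>-1\<^esup>)\<close>, which exists for \<open>S\<close> in \<open>G\<^sub>-\<close>.\<close>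

definition W_series :: "complex fps \<Rightarrow> complex fps fps" where
  "W_series S = (THE W. (in_z fps_X + in_w fps_X) * W
                       = in_w (inverse S) * in_z (inverse S) - 1)"

definition W :: "complex fps \<Rightarrow> nat \<Rightarrow> nat \<Rightarrow> complex" where
  "W S k l = fps_nth (fps_nth (W_series S) l) k"

text \<open>The coefficient of \<open>z\<^sup>i\<close> in \<open>[S\<^bsup>-1\<^esup>(z) q(z)]\<^sub>+\<close>, where \<open>q(z) = \<Sum>\<^sub>n q\<^sub>n z\<^sup>n\<close>.\<close>

definition shifted_q :: "complex fps \<Rightarrow> nat \<Rightarrow> ips" where
  "shifted_q S i = ips_sum (\<lambda>n. ips_const (fps_nth (inverse S) n) * q (i + n))"

text \<open>
  A series \<open>F\<close> is stored in the variables \<open>t\<^sub>i = q\<^sub>i + \<delta>\<^bsub>i,1\<^esub>\<close>, so replacing \<open>q\<close> by \<open>[S\<^bsup>-1\<^esup> q]\<^sub>+\<close>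
  amounts to \<open>t\<^sub>i := ([S\<^bsup>-1\<^esup> q]\<^sub>+)\<^sub>i + \<delta>\<^bsub>i,1\<^esub>\<close>. For reduced \<open>S\<close> the coefficient of \<open>z\<^bsup>-1\<^esup>\<close>
  vanishes and these series have no constant term.
\<close>

definition S_hat :: "complex fps \<Rightarrow> ips \<Rightarrow> ips" where
  "S_hat S F =
     ips_subst F (\<lambda>i. shifted_q S i + (if i = 1 then 1 else 0))
     + ips_const (1/2) * ips_sum (\<lambda>(k, l). ips_const (W S k l) * (q k * q l))"

definition act :: "complex fps set \<Rightarrow> ips \<Rightarrow> ips" where
  "act C = (\<lambda>F \<in> GW0. S_hat (rep C) F)"

end

theory Submission
  imports Defs
begin

text \<open>
  Let \<open>R = S\<^bsup>-1\<^esup>\<close>. For reduced \<open>S\<close> the coefficient \<open>R\<^sub>1\<close> vanishes, so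
  \<open>q \<mapsto> [R q]\<^sub>+\<close> is the linear substitution \<open>t\<^sub>i \<mapsto> \<Sum>\<^sub>n R\<^sub>n t\<^bsub>i+n\<^esub>\<close>, which fixes the origin.
  Identities between power series follow from the chain rule
  \<open>\<partial>\<^sub>k (F \<circ> R) = \<Sum>\<^bsub>i\<le>k\<^esub> R\<^bsub>k-i\<^esub> (\<partial>\<^sub>i F) \<circ> R\<close> by comparing constant terms and inductively derivatives,
  and the coefficients \<open>W\<^bsub>k,l\<^esub>\<close> enter only through
  \<open>W\<^bsub>k-1,l\<^esub> + W\<^bsub>k,l-1\<^esub> = R\<^sub>k R\<^sub>l - \<delta>\<^bsub>k,0\<^esub> \<delta>\<^bsub>l,0\<^esub>\<close>.
  The action is free because it multiplies the series
  \<open>1 + \<Sum>\<^sub>k (\<partial>\<^sub>0 \<partial>\<^sub>k F)(0) z\<^bsup>-k-1\<^esup>\<close> by \<open>R\<close>.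
\<close>

section \<open>Coefficients and derivatives\<close>

abbreviation const_term :: "ips \<Rightarrow> complex" where
  "const_term F \<equiv> ips_nth F {#}"

lemma
  shows ips_nth_zero [simp]: "ips_nth 0 M = 0"
    and ips_nth_one [simp]: "ips_nth 1 M = (if M = {#} then 1 else 0)"
    and ips_nth_add [simp]: "ips_nth (F + G) M = ips_nth F M + ips_nth G M"
    and ips_nth_diff [simp]: "ips_nth (F - G) M = ips_nth F M - ips_nth G M"
    and ips_nth_uminus [simp]: "ips_nth (- F) M = - ips_nth F M"
    and ips_nth_const [simp]: "ips_nth (ips_const c) M = (if M = {#} then c else 0)"
    and ips_nth_var [simp]: "ips_nth (ips_var i) M = (if M = {#i#} then 1 else 0)"
    and ips_nth_deriv [simp]:
      "ips_nth (\<partial> i F) M = of_nat (Suc (count M i)) * ips_nth F (add_mset i M)"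
    and ips_nth_ips_sum [simp]: "ips_nth (ips_sum f) M = Sum_any (\<lambda>i. ips_nth (f i) M)"
  by (transfer; simp)+

lemmas ips_nth_simps = ips_nth_zero ips_nth_one ips_nth_add ips_nth_diff ips_nth_uminus
  ips_nth_const ips_nth_var ips_nth_deriv ips_nth_ips_sum

lemma ips_nth_times:
  "ips_nth (F * G) M = (\<Sum>(A, B) \<in> {(A, B). A + B = M}. ips_nth F A * ips_nth G B)"
  by transfer simp

lemma ips_nth_const_times [simp]: "ips_nth (ips_const c * F) M = c * ips_nth F M"
proof -
  have "ips_nth (ips_const c * F) M
      = (\<Sum>(A, B) \<in> {({#} :: nat multiset, M)}. (if A = {#} then c else 0) * ips_nth F B)"
    unfolding ips_nth_times ips_nth_simps
    by (rule sum.mono_neutral_right) (auto simp: finite_mset_splits split: if_splits)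
  thus ?thesis by simp
qed

lemma ips_nth_sum [simp]: "ips_nth (sum f A) M = (\<Sum>x\<in>A. ips_nth (f x) M)"
  by (induction A rule: infinite_finite_induct) auto

lemma const_term_times [simp]: "const_term (F * G) = const_term F * const_term G"
proof -
  have "{(A, B). A + B = ({#} :: nat multiset)} = {({#}, {#})}" by auto
  thus ?thesis by (simp add: ips_nth_times)
qed

lemma ips_const_hom [simp]:
  "ips_const 0 = 0" "ips_const 1 = 1"
  by (auto intro!: ips_eqI)

lemma ips_const_add: "ips_const (a + b) = ips_const a + ips_const b"
  and ips_const_uminus: "ips_const (- a) = - ips_const a"
  and ips_const_mult: "ips_const (a * b) = ips_const a * ips_const b"
  by (auto intro!: ips_eqI)

lemma ips_const_sum: "ips_const (sum f A) = (\<Sum>x\<in>A. ips_const (f x))"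
  by (auto intro!: ips_eqI)

lemma two_ips_eq: "(2 :: ips) = ips_const 2"
  by (metis ips_const_add ips_const_hom(2) one_add_one)

section \<open>Rules for partial derivatives\<close>

lemma ips_deriv_linear [simp]:
  "\<partial> i (F + G) = \<partial> i F + \<partial> i G"
  "\<partial> i (F - G) = \<partial> i F - \<partial> i G"
  "\<partial> i (- F) = - \<partial> i F"
  "\<partial> i (ips_const c * F) = ips_const c * \<partial> i F"
  "\<partial> i (ips_const c) = 0" "\<partial> i 0 = 0" "\<partial> i 1 = 0"
  by (auto intro!: ips_eqI simp: ring_distribs)

lemma ips_deriv_sum [simp]: "\<partial> i (sum f A) = (\<Sum>x\<in>A. \<partial> i (f x))"
  by (induction A rule: infinite_finite_induct) auto

lemma ips_deriv_var [simp]: "\<partial> i (ips_var j) = (if i = j then 1 else 0)"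
  by (auto intro!: ips_eqI)

lemma ips_deriv_q [simp]: "\<partial> i (q j) = (if i = j then 1 else 0)"
  by (auto simp: q_def)

lemma const_term_q [simp]: "const_term (q i) = (if i = 1 then -1 else 0)"
  by (auto simp: q_def)

lemma ips_deriv_commute: "\<partial> i (\<partial> j F) = \<partial> j (\<partial> i F)"
  by (rule ips_eqI) (auto simp: add_mset_commute)

text \<open>A split \<open>A + B = add_mset i M\<close> has
  \<open>count A i + count B i = Suc (count M i)\<close>, so the scalar in front of the coefficient
  divides into a part acting on \<open>F\<close> and a part acting on \<open>G\<close>.\<close>

lemma ips_deriv_times:
  "\<partial> i (F * G) = \<partial> i F * G + F * \<partial> i G"
proof (rule ips_eqI)
  fix M
  let ?S = "{(A, B). A + B = add_mset i M}" and ?S' = "{(A, B). A + B = M}"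
  have fin: "finite ?S" "finite ?S'" by (simp_all add: finite_mset_splits)
  have cnt: "Suc (count M i) = count A i + count B i" if "(A, B) \<in> ?S" for A B
    using that by (metis (mono_tags, lifting) case_prodD count_add_mset count_union mem_Collect_eq)
  have "ips_nth (\<partial> i (F * G)) M
      = (\<Sum>(A, B) \<in> ?S. of_nat (Suc (count M i)) * (ips_nth F A * ips_nth G B))"
    by (simp add: ips_nth_times sum_distrib_left case_prod_unfold)
  also have "\<dots> = (\<Sum>(A, B) \<in> ?S. of_nat (count A i) * ips_nth F A * ips_nth G B
      + ips_nth F A * (of_nat (count B i) * ips_nth G B))"
  proof (intro sum.cong refl, clarify)
    fix A B assume "A + B = add_mset i M"
    hence "Suc (count M i) = count A i + count B i" using cnt by auto
    thus "complex_of_nat (Suc (count M i)) * (ips_nth F A * ips_nth G B)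
      = of_nat (count A i) * ips_nth F A * ips_nth G B
      + ips_nth F A * (of_nat (count B i) * ips_nth G B)"
      by (simp only: of_nat_add) (simp add: algebra_simps)
  qed
  also have "\<dots> = (\<Sum>(A, B) \<in> ?S. of_nat (count A i) * ips_nth F A * ips_nth G B)
      + (\<Sum>(A, B) \<in> ?S. ips_nth F A * (of_nat (count B i) * ips_nth G B))"
    by (simp add: case_prod_unfold sum.distrib)
  \<comment> \<open>The factor \<open>count A i\<close> kills the splits with no \<open>i\<close> in
    \<open>A\<close>; the others arise uniquely by adding \<open>i\<close> to the left part of a
    split of \<open>M\<close>.\<close>
  also have "(\<Sum>(A, B) \<in> ?S. of_nat (count A i) * ips_nth F A * ips_nth G B)
      = (\<Sum>(A, B) \<in> (\<lambda>(A, B). (add_mset i A, B)) ` ?S'. of_nat (count A i) * ips_nth F A * ips_nth G B)"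
  proof (rule sum.mono_neutral_right[OF fin(1)], force, clarify)
    fix A B assume *: "(A, B) \<notin> (\<lambda>(A, B). (add_mset i A, B)) ` ?S'" "A + B = add_mset i M"
    have "i \<notin># A"
    proof
      assume "i \<in># A"
      then obtain A' where "A = add_mset i A'" by (metis insert_DiffM)
      with * show False by force
    qed
    thus "of_nat (count A i) * ips_nth F A * ips_nth G B = 0" by (simp add: not_in_iff)
  qed
  also have "\<dots> = ips_nth (\<partial> i F * G) M"
    unfolding ips_nth_times
    by (subst sum.reindex) (auto simp: inj_on_def case_prod_unfold)
  also have "(\<Sum>(A, B) \<in> ?S. ips_nth F A * (of_nat (count B i) * ips_nth G B))
      = (\<Sum>(A, B) \<in> (\<lambda>(A, B). (A, add_mset i B)) ` ?S'. ips_nth F A * (of_nat (count B i) * ips_nth G B))"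
  proof (rule sum.mono_neutral_right[OF fin(1)], force, clarify)
    fix A B assume *: "(A, B) \<notin> (\<lambda>(A, B). (A, add_mset i B)) ` ?S'" "A + B = add_mset i M"
    have "i \<notin># B"
    proof
      assume "i \<in># B"
      then obtain B' where "B = add_mset i B'" by (metis insert_DiffM)
      with * show False by force
    qed
    thus "ips_nth F A * (of_nat (count B i) * ips_nth G B) = 0" by (simp add: not_in_iff)
  qed
  also have "\<dots> = ips_nth (F * \<partial> i G) M"
    unfolding ips_nth_times
    by (subst sum.reindex) (auto simp: inj_on_def case_prod_unfold)
  finally show "ips_nth (\<partial> i (F * G)) M = ips_nth (\<partial> i F * G + F * \<partial> i G) M" by simp
qed

lemma ips_deriv_square: "\<partial> k (F\<^sup>2) = ips_const 2 * (\<partial> k F * F)"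
  by (simp add: power2_eq_square ips_deriv_times two_ips_eq[symmetric] mult.commute)

lemma ips_const_half_double: "ips_const (1/2) * (ips_const 2 * F) = F"
  by (rule ips_eqI) simp

text \<open>Allows induction on the degree where derivatives agree only up to terms of the same kind.\<close>

definition eq_below :: "nat \<Rightarrow> ips \<Rightarrow> ips \<Rightarrow> bool" where
  "eq_below n F G \<longleftrightarrow> (\<forall>M. size M < n \<longrightarrow> ips_nth F M = ips_nth G M)"

lemma eq_below_0 [simp]: "eq_below 0 F G"
  by (simp add: eq_below_def)

lemma eq_below_refl [simp]: "eq_below n F F"
  by (simp add: eq_below_def)

text \<open>In characteristic zero the coefficient at \<open>add_mset i N\<close> is recovered from
  that of the \<open>i\<close>-th derivative at \<open>N\<close>, on dividing by the nonzero number
  \<open>Suc (count N i)\<close>.\<close>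

lemma eq_below_Suc:
  assumes "const_term F = const_term G" "\<And>i. eq_below n (\<partial> i F) (\<partial> i G)"
  shows "eq_below (Suc n) F G"
  unfolding eq_below_def
proof (intro allI impI)
  fix M :: "nat multiset" assume M: "size M < Suc n"
  show "ips_nth F M = ips_nth G M"
  proof (cases M)
    case empty thus ?thesis using assms by simp
  next
    case (add i N)
    with M assms(2)[of i] have "ips_nth (\<partial> i F) N = ips_nth (\<partial> i G) N"
      by (simp add: eq_below_def)
    hence "complex_of_nat (Suc (count N i)) * ips_nth F (add_mset i N)
        = of_nat (Suc (count N i)) * ips_nth G (add_mset i N)" by simp
    hence "ips_nth F (add_mset i N) = ips_nth G (add_mset i N)"
      by (simp only: mult_cancel_left of_nat_eq_0_iff) simp
    thus ?thesis by (simp add: add)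
  qed
qed

lemma eq_below_add: "eq_below n F G \<Longrightarrow> eq_below n F' G' \<Longrightarrow> eq_below n (F + F') (G + G')"
  by (simp add: eq_below_def)

lemma eq_below_const_times: "eq_below n F G \<Longrightarrow> eq_below n (ips_const c * F) (ips_const c * G)"
  by (simp add: eq_below_def)

lemma eq_below_sum: "(\<And>x. x \<in> A \<Longrightarrow> eq_below n (f x) (g x)) \<Longrightarrow> eq_below n (sum f A) (sum g A)"
  by (simp add: eq_below_def)

lemma ips_eq_eq_belowI: "(\<And>n. eq_below n F G) \<Longrightarrow> F = G"
  by (rule ips_eqI) (auto simp: eq_below_def)

lemma ips_eq_derivI:
  assumes "const_term F = const_term G" "\<And>i. \<partial> i F = \<partial> i G"
  shows "F = G"
proof (rule ips_eq_eq_belowI)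
  fix n
  have "eq_below (Suc n) F G" by (rule eq_below_Suc) (simp_all add: assms)
  thus "eq_below n F G" by (simp add: eq_below_def)
qed

section \<open>Infinite sums of series\<close>

definition locally_finite :: "('i \<Rightarrow> ips) \<Rightarrow> bool" where
  "locally_finite f \<longleftrightarrow> (\<forall>M. finite {i. ips_nth (f i) M \<noteq> 0})"

text \<open>Each coefficient of a derivative is one coefficient of the original times a fixed
  nonzero number, so the supports agree and even the default value 0 on an infinite support is
  respected.\<close>

lemma ips_deriv_ips_sum: "\<partial> k (ips_sum f) = ips_sum (\<lambda>i. \<partial> k (f i))"
proof (rule ips_eqI)
  fix M
  let ?c = "complex_of_nat (Suc (count M k))"
  have c: "?c \<noteq> 0" by (simp del: of_nat_Suc)
  have "?c * Sum_any (\<lambda>i. ips_nth (f i) (add_mset k M))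
      = Sum_any (\<lambda>i. ?c * ips_nth (f i) (add_mset k M))"
    using c by (simp add: Sum_any.expand_set sum_distrib_left del: of_nat_Suc)
  thus "ips_nth (\<partial> k (ips_sum f)) M = ips_nth (ips_sum (\<lambda>i. \<partial> k (f i))) M" by simp
qed

lemma sum_any_sum_swap:
  fixes f :: "'i \<Rightarrow> 'j \<Rightarrow> 'a :: comm_monoid_add"
  assumes "\<And>i. finite {N. f i N \<noteq> 0}"
  shows "Sum_any (\<lambda>N. \<Sum>i\<in>A. f i N) = (\<Sum>i\<in>A. Sum_any (f i))"
proof (induction A rule: infinite_finite_induct)
  case (insert x A)
  have "finite {N. (\<Sum>i\<in>A. f i N) \<noteq> 0}"
    by (rule finite_subset[of _ "\<Union>i\<in>A. {N. f i N \<noteq> 0}"])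
       (auto simp: assms insert.hyps intro: ccontr sum.neutral)
  thus ?case using insert by (simp add: Sum_any.distrib[OF assms])
qed auto

text \<open>Local finiteness matters here: \<open>Sum_any\<close> is 0 on an infinite support, which
  would break additivity.\<close>

lemma ips_sum_add:
  "locally_finite f \<Longrightarrow> locally_finite g \<Longrightarrow> ips_sum (\<lambda>i. f i + g i) = ips_sum f + ips_sum g"
  by (rule ips_eqI) (simp add: locally_finite_def Sum_any.distrib)

lemma ips_sum_const_times:
  "ips_sum (\<lambda>i. ips_const c * f i) = ips_const c * ips_sum f"
  by (cases "c = 0") (auto intro!: ips_eqI simp: Sum_any.expand_set sum_distrib_left)

lemma ips_sum_finite_support:
  assumes "finite A" "\<And>i. i \<notin> A \<Longrightarrow> f i = 0"
  shows "ips_sum f = sum f A"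
proof (rule ips_eqI)
  fix M
  have "{i. ips_nth (f i) M \<noteq> 0} \<subseteq> A" using assms(2) by force
  thus "ips_nth (ips_sum f) M = ips_nth (sum f A) M"
    using assms(1) by (simp add: Sum_any.expand_superset)
qed

section \<open>Linear substitutions\<close>

definition lin_form :: "complex fps \<Rightarrow> nat \<Rightarrow> ips" where
  "lin_form R i = ips_sum (\<lambda>n. ips_const (fps_nth R n) * ips_var (i + n))"

lemma const_term_lin_form [simp]: "const_term (lin_form R i) = 0"
  by (simp add: lin_form_def)

lemma ips_deriv_lin_form: "\<partial> k (lin_form R i) = (if i \<le> k then ips_const (fps_nth R (k - i)) else 0)"
  unfolding lin_form_def ips_deriv_ips_sum
  by (subst ips_sum_finite_support[where A = "if i \<le> k then {k - i} else {}"]) auto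

definition lin_monom :: "complex fps \<Rightarrow> nat multiset \<Rightarrow> ips" where
  "lin_monom R N = prod_mset (image_mset (lin_form R) N)"

lemma lin_monom_simps [simp]:
  "lin_monom R {#} = 1" "lin_monom R (add_mset i N) = lin_form R i * lin_monom R N"
  by (simp_all add: lin_monom_def)

lemma const_term_lin_monom: "const_term (lin_monom R N) = (if N = {#} then 1 else 0)"
  by (cases N) auto

text \<open>Only the forms \<open>lin_form R i\<close> with \<open>i \<le> k\<close> can contain
  t_k; grouping the Leibniz terms by \<open>i\<close> produces the multiplicity
  \<open>count N i\<close>.\<close>

lemma ips_deriv_lin_monom:
  "\<partial> k (lin_monom R N)
     = (\<Sum>i\<le>k. ips_const (fps_nth R (k - i) * of_nat (count N i)) * lin_monom R (N - {#i#}))"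
proof (induction N)
  case (add j N)
  \<comment> \<open>If \<open>i\<close> is missing from \<open>N\<close>, its multiplicity is 0 and
    both sides vanish, whatever \<open>N - {#i#}\<close> means there.\<close>
  have step: "lin_form R j * (ips_const (fps_nth R (k - i) * of_nat (count N i)) * lin_monom R (N - {#i#}))
      = ips_const (fps_nth R (k - i) * of_nat (count N i)) * lin_monom R (add_mset j N - {#i#})" for i
  proof (cases "i \<in># N")
    case True
    hence "add_mset j N - {#i#} = add_mset j (N - {#i#})" by auto
    thus ?thesis by (simp add: ac_simps)
  qed (simp add: not_in_iff)
  have "\<partial> k (lin_monom R (add_mset j N))
      = (if j \<le> k then ips_const (fps_nth R (k - j)) * lin_monom R N else 0)
        + (\<Sum>i\<le>k. ips_const (fps_nth R (k - i) * of_nat (count N i)) * lin_monom R (add_mset j N - {#i#}))"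
    by (simp add: ips_deriv_times ips_deriv_lin_form add.IH sum_distrib_left step)
  also have "(if j \<le> k then ips_const (fps_nth R (k - j)) * lin_monom R N else 0)
      = (\<Sum>i\<le>k. if i = j then ips_const (fps_nth R (k - i)) * lin_monom R (add_mset j N - {#i#}) else 0)"
    by (simp add: sum.delta)
  finally show ?case
    by (simp only: sum.distrib[symmetric])
       (auto intro!: sum.cong simp: ips_const_add ring_distribs)
qed simp

text \<open>Differentiating in t_k passes from \<open>add_mset k M\<close> to \<open>M\<close> and
  removes from \<open>N\<close> an index at most \<open>k\<close>, so each variable of the monomial
  leaves finitely many choices. This makes the substitution meaningful for arbitrary
  \<open>F\<close>.\<close>

lemma finite_support_lin_monom: "finite {N. ips_nth (lin_monom R N) M \<noteq> 0}"
proof (induction M)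
  case empty
  show ?case by (simp add: const_term_lin_monom)
next
  case (add k M)
  have "{N. ips_nth (lin_monom R N) (add_mset k M) \<noteq> 0}
      \<subseteq> (\<Union>i\<le>k. add_mset i ` {N. ips_nth (lin_monom R N) M \<noteq> 0})"
  proof
    fix N assume "N \<in> {N. ips_nth (lin_monom R N) (add_mset k M) \<noteq> 0}"
    hence "ips_nth (\<partial> k (lin_monom R N)) M \<noteq> 0" by (simp del: of_nat_Suc)
    then obtain i where i: "i \<le> k"
      "ips_nth (ips_const (fps_nth R (k - i) * of_nat (count N i)) * lin_monom R (N - {#i#})) M \<noteq> 0"
      unfolding ips_deriv_lin_monom ips_nth_sum by (metis (no_types, lifting) atMost_iff sum.neutral)
    hence "i \<in># N" "ips_nth (lin_monom R (N - {#i#})) M \<noteq> 0"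
      by (auto simp: count_eq_zero_iff)
    thus "N \<in> (\<Union>i\<le>k. add_mset i ` {N. ips_nth (lin_monom R N) M \<noteq> 0})"
      using i(1) by (intro UN_I[of i] image_eqI[of N "add_mset i" "N - {#i#}"]) auto
  qed
  thus ?case by (rule finite_subset) (simp add: add.IH)
qed

definition lin_subst :: "complex fps \<Rightarrow> ips \<Rightarrow> ips" where
  "lin_subst R F = ips_subst F (lin_form R)"

lemma ips_nth_lin_subst:
  "ips_nth (lin_subst R F) M = Sum_any (\<lambda>N. ips_nth F N * ips_nth (lin_monom R N) M)"
  by (simp add: lin_subst_def ips_subst_def lin_monom_def)

lemma lin_subst_finite: "finite {N. f N * ips_nth (lin_monom R N) M \<noteq> 0}"
  by (rule finite_subset[OF _ finite_support_lin_monom[of R M]]) auto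

lemma const_term_lin_subst [simp]: "const_term (lin_subst R F) = const_term F"
  unfolding ips_nth_lin_subst const_term_lin_monom
  by (subst Sum_any.expand_superset[of "{{#}}"]) auto

lemma lin_subst_add [simp]: "lin_subst R (F + G) = lin_subst R F + lin_subst R G"
  by (rule ips_eqI) (simp add: ips_nth_lin_subst ring_distribs Sum_any.distrib[OF lin_subst_finite lin_subst_finite])

lemma lin_subst_const_times [simp]: "lin_subst R (ips_const c * F) = ips_const c * lin_subst R F"
  by (rule ips_eqI) (simp add: ips_nth_lin_subst Sum_any_right_distrib[OF lin_subst_finite] mult.assoc)

lemma lin_subst_uminus [simp]: "lin_subst R (- F) = - lin_subst R F"
  using lin_subst_const_times[of R "-1" F] by (simp add: ips_const_uminus)

lemma lin_subst_zero [simp]: "lin_subst R 0 = 0"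
  using lin_subst_const_times[of R 0 0] by simp

lemma lin_subst_sum [simp]: "lin_subst R (sum f A) = (\<Sum>x\<in>A. lin_subst R (f x))"
  by (induction A rule: infinite_finite_induct) auto

text \<open>Termwise differentiation, followed by the reindexing \<open>N = add_mset i N'\<close>
  that turns multiplicities into coefficients of \<partial> i F. Together with the constant term
  this rule yields the later identities for \<open>lin_subst\<close>.\<close>

lemma ips_deriv_lin_subst:
  "\<partial> k (lin_subst R F) = (\<Sum>i\<le>k. ips_const (fps_nth R (k - i)) * lin_subst R (\<partial> i F))"
proof (rule ips_eqI)
  fix M
  let ?m = "\<lambda>N. ips_nth (lin_monom R N) M"
  have one: "Sum_any (\<lambda>N. (ips_nth F N * of_nat (count N i)) * ?m (N - {#i#}))
      = ips_nth (lin_subst R (\<partial> i F)) M" (is "Sum_any ?f = _") for i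
  proof -
    let ?g = "\<lambda>N. ips_nth (\<partial> i F) N * ?m N"
    have "{N. ?f N \<noteq> 0} = add_mset i ` {N. ?g N \<noteq> 0}"
    proof (intro equalityI subsetI)
      fix N assume *: "N \<in> {N. ?f N \<noteq> 0}"
      hence "i \<in># N" by (auto simp: count_eq_zero_iff)
      then obtain N' where N': "N = add_mset i N'" by (metis insert_DiffM)
      with * show "N \<in> add_mset i ` {N. ?g N \<noteq> 0}" by (auto simp del: of_nat_Suc)
    qed (auto simp del: of_nat_Suc)
    hence "Sum_any ?f = sum ?f (add_mset i ` {N. ?g N \<noteq> 0})"
      by (simp only: Sum_any.expand_set)
    also have "\<dots> = sum ?g {N. ?g N \<noteq> 0}"
      by (subst sum.reindex) (auto simp: ac_simps inj_on_def)
    also have "\<dots> = ips_nth (lin_subst R (\<partial> i F)) M"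
      by (simp only: ips_nth_lin_subst Sum_any.expand_set)
    finally show ?thesis .
  qed
  have fin: "finite {N. (ips_nth F N * of_nat (count N i)) * ?m (N - {#i#}) \<noteq> 0}" for i
  proof (rule finite_subset)
    show "{N. (ips_nth F N * of_nat (count N i)) * ?m (N - {#i#}) \<noteq> 0} \<subseteq> add_mset i ` {N. ?m N \<noteq> 0}"
    proof
      fix N assume *: "N \<in> {N. (ips_nth F N * of_nat (count N i)) * ?m (N - {#i#}) \<noteq> 0}"
      hence "i \<in># N" by (auto simp: count_eq_zero_iff)
      then obtain N' where N': "N = add_mset i N'" by (metis insert_DiffM)
      with * show "N \<in> add_mset i ` {N. ?m N \<noteq> 0}" by auto
    qed
  qed (use finite_support_lin_monom in auto)
  have "ips_nth (\<partial> k (lin_subst R F)) M = ips_nth (\<partial> k (ips_sum (\<lambda>N. ips_const (ips_nth F N) * lin_monom R N))) M"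
    by (simp only: lin_subst_def ips_subst_def lin_monom_def)
  also have "\<dots> = Sum_any (\<lambda>N. ips_nth F N * ips_nth (\<partial> k (lin_monom R N)) M)"
    unfolding ips_deriv_ips_sum by (simp only: ips_deriv_linear ips_nth_ips_sum ips_nth_const_times)
  also have "\<dots> = Sum_any (\<lambda>N. \<Sum>i\<le>k. fps_nth R (k - i) * ((ips_nth F N * of_nat (count N i)) * ?m (N - {#i#})))"
    by (simp only: ips_deriv_lin_monom ips_nth_sum ips_nth_const_times sum_distrib_left)
       (simp only: ac_simps)
  also have "\<dots> = (\<Sum>i\<le>k. Sum_any (\<lambda>N. fps_nth R (k - i) * ((ips_nth F N * of_nat (count N i)) * ?m (N - {#i#}))))"
  proof (rule sum_any_sum_swap)
    fix i show "finite {N. fps_nth R (k - i) * ((ips_nth F N * of_nat (count N i)) * ?m (N - {#i#})) \<noteq> 0}"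
      by (rule finite_subset[OF _ fin[of i]]) auto
  qed
  also have "\<dots> = (\<Sum>i\<le>k. fps_nth R (k - i) * ips_nth (lin_subst R (\<partial> i F)) M)"
    by (simp only: Sum_any_right_distrib[OF fin, symmetric] one)
  finally show "ips_nth (\<partial> k (lin_subst R F)) M
      = ips_nth (\<Sum>i\<le>k. ips_const (fps_nth R (k - i)) * lin_subst R (\<partial> i F)) M" by simp
qed

lemma lin_subst_const [simp]: "lin_subst R (ips_const c) = ips_const c"
  by (rule ips_eq_derivI) (simp_all add: ips_deriv_lin_subst)

lemma lin_subst_unit [simp]: "lin_subst R 1 = 1"
  using lin_subst_const[of R 1] by simp

text \<open>By the Leibniz and chain rules the derivatives of both sides are the same combination of
  instances for \<open>(\<partial> i F, G)\<close> and \<open>(F, \<partial> i G)\<close>. These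
  instances are themselves unproved, so the induction runs on the degree with \<open>F\<close> and
  \<open>G\<close> arbitrary.\<close>

lemma lin_subst_times: "lin_subst R (F * G) = lin_subst R F * lin_subst R G"
proof (rule ips_eq_eq_belowI)
  show "eq_below n (lin_subst R (F * G)) (lin_subst R F * lin_subst R G)" for n
  proof (induction n arbitrary: F G)
    case (Suc n)
    show ?case
    proof (rule eq_below_Suc)
      fix k
      have "\<partial> k (lin_subst R F * lin_subst R G) = (\<Sum>i\<le>k. ips_const (fps_nth R (k - i))
          * (lin_subst R (\<partial> i F) * lin_subst R G + lin_subst R F * lin_subst R (\<partial> i G)))"
        by (simp add: ips_deriv_times ips_deriv_lin_subst sum_distrib_left sum_distrib_right
            ring_distribs sum.distrib ac_simps)
      moreover have "\<partial> k (lin_subst R (F * G)) = (\<Sum>i\<le>k. ips_const (fps_nth R (k - i))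
          * (lin_subst R (\<partial> i F * G) + lin_subst R (F * \<partial> i G)))"
        by (simp add: ips_deriv_lin_subst ips_deriv_times)
      ultimately show "eq_below n (\<partial> k (lin_subst R (F * G))) (\<partial> k (lin_subst R F * lin_subst R G))"
        by (simp add: eq_below_sum eq_below_const_times eq_below_add Suc)
    qed simp
  qed simp
qed

text \<open>The chain rule coefficients R_{k-i} and R'_{i-j} convolve to those of the product
  series.\<close>

lemma lin_subst_lin_subst: "lin_subst R (lin_subst R' F) = lin_subst (R * R') F"
proof (rule ips_eq_eq_belowI)
  show "eq_below n (lin_subst R (lin_subst R' F)) (lin_subst (R * R') F)" for n
  proof (induction n arbitrary: F)
    case (Suc n)
    show ?case
    proof (rule eq_below_Suc)
      fix k
      have "\<partial> k (lin_subst R (lin_subst R' F)) = (\<Sum>i\<le>k. \<Sum>j\<le>i. 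
          ips_const (fps_nth R (k - i) * fps_nth R' (i - j)) * lin_subst R (lin_subst R' (\<partial> j F)))"
        by (simp add: ips_deriv_lin_subst ips_const_mult sum_distrib_left mult.assoc)
      also have "\<dots> = (\<Sum>j\<le>k. \<Sum>i=j..k. 
          ips_const (fps_nth R (k - i) * fps_nth R' (i - j)) * lin_subst R (lin_subst R' (\<partial> j F)))"
        unfolding sum.Sigma[OF finite_atMost ballI[OF finite_atMost]]
          sum.Sigma[OF finite_atMost ballI[OF finite_atLeastAtMost]]
        by (rule sum.reindex_bij_witness[of _ prod.swap prod.swap]) auto
      also have "\<dots> = (\<Sum>j\<le>k. ips_const (fps_nth (R * R') (k - j)) * lin_subst R (lin_subst R' (\<partial> j F)))"
      proof (intro sum.cong refl)
        fix j assume j: "j \<in> {..k}"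
        have "(\<Sum>i=j..k. fps_nth R (k - i) * fps_nth R' (i - j)) = fps_nth (R * R') (k - j)"
          unfolding fps_mult_nth
          by (rule sum.reindex_bij_witness[of _ "\<lambda>i. k - i" "\<lambda>i. k - i"]) (use j in auto)
        thus "(\<Sum>i=j..k. ips_const (fps_nth R (k - i) * fps_nth R' (i - j)) * lin_subst R (lin_subst R' (\<partial> j F)))
            = ips_const (fps_nth (R * R') (k - j)) * lin_subst R (lin_subst R' (\<partial> j F))"
          by (simp only: sum_distrib_right[symmetric] ips_const_sum[symmetric])
      qed
      finally show "eq_below n (\<partial> k (lin_subst R (lin_subst R' F))) (\<partial> k (lin_subst (R * R') F))"
        by (simp add: ips_deriv_lin_subst eq_below_sum eq_below_const_times Suc)
    qed simp
  qed simp
qed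

lemma lin_subst_one [simp]: "lin_subst 1 F = F"
proof (rule ips_eq_eq_belowI)
  show "eq_below n (lin_subst 1 F) F" for n
  proof (induction n arbitrary: F)
    case (Suc n)
    have "\<partial> k (lin_subst 1 F) = (\<Sum>i\<le>k. if i = k then lin_subst 1 (\<partial> i F) else 0)" for k
      unfolding ips_deriv_lin_subst by (intro sum.cong refl) auto
    thus ?case by (intro eq_below_Suc) (auto simp: Suc)
  qed simp
qed

section \<open>The Euler and string vector fields and quadratic forms\<close>

text \<open>\<open>s = 0\<close> gives the operator of (DE), \<open>s = 1\<close> that of (SE).\<close>

definition euler :: "nat \<Rightarrow> ips \<Rightarrow> ips" where
  "euler s F = ips_sum (\<lambda>i. q (i + s) * \<partial> i F)"

lemma q_times: "q j * G = ips_var j * G - (if j = 1 then G else 0)"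
  by (simp add: q_def algebra_simps)

lemma ips_nth_q_times_eq_0:
  assumes "j \<notin># M" "j \<noteq> 1"
  shows "ips_nth (q j * G) M = 0"
  unfolding q_times ips_nth_simps ips_nth_times
  using assms by (auto intro!: sum.neutral)

lemma locally_finite_euler: "locally_finite (\<lambda>i. q (i + s) * G i)"
  unfolding locally_finite_def
proof
  fix M
  have "finite ((\<lambda>i. i + s) -` insert 1 (set_mset M))"
    by (rule finite_vimageI) (auto simp: inj_on_def)
  thus "finite {i. ips_nth (q (i + s) * G i) M \<noteq> 0}"
    by (rule rev_finite_subset) (use ips_nth_q_times_eq_0 in auto)
qed

lemma euler_add: "euler s (F + G) = euler s F + euler s G"
  by (simp add: euler_def ring_distribs ips_sum_add locally_finite_euler)

lemma euler_const_times: "euler s (ips_const c * F) = ips_const c * euler s F"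
  by (simp add: euler_def ips_sum_const_times[symmetric] mult.left_commute)

lemma euler_zero [simp]: "euler s 0 = 0"
  using euler_const_times[of s 0 0] by simp

lemma euler_sum: "euler s (sum f A) = (\<Sum>x\<in>A. euler s (f x))"
  by (induction A rule: infinite_finite_induct) (auto simp: euler_add)

lemma euler_const [simp]: "euler s (ips_const c) = 0"
  by (auto simp: euler_def intro!: ips_eqI)

text \<open>At the origin \<open>q j\<close> is -1 for \<open>j = 1\<close> and 0 otherwise, which
  leaves the index \<open>1 - s\<close>.\<close>

lemma const_term_euler:
  assumes "s \<le> 1"
  shows "const_term (euler s F) = - const_term (\<partial> (1 - s) F)"
  unfolding euler_def ips_nth_ips_sum const_term_times
  by (subst Sum_any.expand_superset[of "{1 - s}"]) (use assms in \<open>auto split: if_splits\<close>)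

text \<open>The extra term comes from \<partial> k hitting the factor \<open>q (i + s)\<close>, that
  is from \<open>i = k - s\<close>.\<close>

lemma ips_deriv_euler:
  "\<partial> k (euler s F) = euler s (\<partial> k F) + (if s \<le> k then \<partial> (k - s) F else 0)"
proof -
  have fin: "locally_finite (\<lambda>i. if k = i + s then \<partial> i F else 0)"
    unfolding locally_finite_def
    by (intro allI, rule finite_subset[of _ "{k - s}"]) (auto split: if_splits)
  have "\<partial> k (euler s F)
      = ips_sum (\<lambda>i. q (i + s) * \<partial> i (\<partial> k F) + (if k = i + s then \<partial> i F else 0))"
    unfolding euler_def ips_deriv_ips_sum
    by (rule arg_cong[of _ _ ips_sum]) (auto simp: ips_deriv_times ips_deriv_commute[of k])
  also have "\<dots> = euler s (\<partial> k F) + ips_sum (\<lambda>i. if k = i + s then \<partial> i F else 0)"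
    by (simp only: ips_sum_add[OF locally_finite_euler fin] euler_def)
  also have "ips_sum (\<lambda>i. if k = i + s then \<partial> i F else 0) = (if s \<le> k then \<partial> (k - s) F else 0)"
    by (subst ips_sum_finite_support[of "if s \<le> k then {k - s} else {}"]) auto
  finally show ?thesis .
qed

text \<open>The field sends q(z) to the nonnegative part of z^{-s} q(z), which commutes with
  multiplication by R(z) followed by truncation. In coordinates, the chain rule coefficients are
  invariant under shifting both indices by \<open>s\<close>.\<close>

lemma lin_subst_euler:
  assumes R: "fps_nth R 0 = 1" "fps_nth R 1 = 0" and s: "s \<le> 1"
  shows "lin_subst R (euler s F) = euler s (lin_subst R F)"
proof (rule ips_eq_eq_belowI)
  show "eq_below n (lin_subst R (euler s F)) (euler s (lin_subst R F))" for n
  proof (induction n arbitrary: F)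
    case (Suc n)
    show ?case
    proof (rule eq_below_Suc)
      \<comment> \<open>For \<open>s = 0\<close> this compares \<partial> 1 at the origin, where R_1
        = 0 removes the contribution of \<partial> 0; for \<open>s = 1\<close> only R_0 = 1
        enters.\<close>
      have "s = 0 \<or> s = 1" using s by auto
      hence "const_term (\<partial> (1 - s) (lin_subst R F)) = const_term (\<partial> (1 - s) F)"
        using R by (auto simp: ips_deriv_lin_subst simp del: ips_nth_deriv)
      thus "const_term (lin_subst R (euler s F)) = const_term (euler s (lin_subst R F))"
        by (simp only: const_term_lin_subst const_term_euler[OF s])
    next
      fix k
      let ?D = "\<lambda>k F. \<Sum>i\<le>k. ips_const (fps_nth R (k - i)) * lin_subst R (\<partial> i F)"
      have shift: "(\<Sum>i\<le>k. ips_const (fps_nth R (k - i)) * lin_subst R (if s \<le> i then \<partial> (i - s) F else 0))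
          = (if s \<le> k then ?D (k - s) F else 0)"
      proof -
        have "(\<Sum>i\<le>k. ips_const (fps_nth R (k - i)) * lin_subst R (if s \<le> i then \<partial> (i - s) F else 0))
            = (\<Sum>i=s..k. ips_const (fps_nth R (k - i)) * lin_subst R (\<partial> (i - s) F))"
          by (rule sum.mono_neutral_cong_right) auto
        also have "\<dots> = (if s \<le> k then ?D (k - s) F else 0)"
        proof (cases "s \<le> k")
          case True
          have "(\<Sum>i=s..k. ips_const (fps_nth R (k - i)) * lin_subst R (\<partial> (i - s) F)) = ?D (k - s) F"
            by (rule sum.reindex_bij_witness[of _ "\<lambda>i. i + s" "\<lambda>i. i - s"]) (use True in auto)
          thus ?thesis using True by simp
        qed simp
        finally show ?thesis .
      qed
      have "\<partial> k (lin_subst R (euler s F)) = (\<Sum>i\<le>k. ips_const (fps_nth R (k - i)) * lin_subst R (euler s (\<partial> i F)))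
          + (if s \<le> k then ?D (k - s) F else 0)"
        by (simp only: ips_deriv_lin_subst ips_deriv_euler lin_subst_add ring_distribs sum.distrib shift)
      moreover have "\<partial> k (euler s (lin_subst R F)) = (\<Sum>i\<le>k. ips_const (fps_nth R (k - i)) * euler s (lin_subst R (\<partial> i F)))
          + (if s \<le> k then ?D (k - s) F else 0)"
        by (simp only: ips_deriv_euler ips_deriv_lin_subst euler_sum euler_const_times)
      ultimately show "eq_below n (\<partial> k (lin_subst R (euler s F))) (\<partial> k (euler s (lin_subst R F)))"
        by (simp only: eq_below_add eq_below_sum eq_below_const_times Suc eq_below_refl)
    qed
  qed simp
qed

section \<open>Quadratic forms in the shifted coordinates\<close>

definition quad :: "(nat \<Rightarrow> nat \<Rightarrow> complex) \<Rightarrow> ips" where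
  "quad w = ips_const (1/2) * ips_sum (\<lambda>(k, l). ips_const (w k l) * (q k * q l))"

text \<open>Tailored to \<open>quad\<close>: its second derivatives are constants, so identities
  become comparisons of numbers. The first two conditions are there because the shift in
  \<open>q 1\<close> adds linear and constant terms in the t variables.\<close>

lemma ips_eq_second_derivI:
  assumes "const_term F = const_term G" "\<And>k. const_term (\<partial> k F) = const_term (\<partial> k G)"
    "\<And>k l. \<partial> l (\<partial> k F) = \<partial> l (\<partial> k G)"
  shows "F = G"
  by (rule ips_eq_derivI[OF assms(1)], rule ips_eq_derivI[OF assms(2)], rule assms(3))

lemma const_term_quad: "const_term (quad w) = w 1 1 / 2"
proof -
  have "Sum_any (\<lambda>(k, l). w k l * ((if k = 1 then -1 else 0) * (if l = 1 then -1 else 0))) = w 1 1"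
    by (subst Sum_any.expand_superset[of "{(1, 1)}"]) (auto split: if_splits)
  thus ?thesis by (simp add: quad_def case_prod_unfold)
qed

text \<open>Symmetry makes both Leibniz halves equal to the form given by row \<open>k\<close> of
  \<open>w\<close>, which cancels the factor 1/2.\<close>

lemma ips_deriv_quad:
  assumes sym: "\<And>k l. w k l = w l k"
  shows "\<partial> k (quad w) = ips_sum (\<lambda>l. ips_const (w k l) * q l)"
proof -
  let ?L = "\<lambda>f. ips_sum (\<lambda>l. ips_const (f l) * q l)"
  let ?g = "\<lambda>i j. (if k = i then ips_const (w i j) * q j else 0)"
  let ?h = "\<lambda>i j. (if k = j then ips_const (w i j) * q i else 0)"
  \<comment> \<open>Besides the variables of \<open>M\<close> only \<open>l = 1\<close> contributes,
    because of the dilaton shift. With the other index fixed to \<open>k\<close> each half is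
    locally finite.\<close>
  have q0: "ips_nth (q l) M = 0" if "l \<notin> insert 1 (set_mset M)" for l M
    using that by (auto simp: q_def)
  have g: "locally_finite (\<lambda>(i, j). ?g i j)"
    unfolding locally_finite_def
  proof
    fix M
    have "ips_nth ((\<lambda>(i, j). ?g i j) x) M = 0" if "x \<notin> {k} \<times> insert 1 (set_mset M)" for x
    proof (cases x)
      case (Pair i j)
      show ?thesis
        by (cases "k = i") (use that q0[of j M] in \<open>auto simp: Pair\<close>)
    qed
    hence "{x. ips_nth ((\<lambda>(i, j). ?g i j) x) M \<noteq> 0} \<subseteq> {k} \<times> insert 1 (set_mset M)" by blast
    thus "finite {x. ips_nth ((\<lambda>(i, j). ?g i j) x) M \<noteq> 0}" by (rule finite_subset) simp
  qed
  have h: "locally_finite (\<lambda>(i, j). ?h i j)"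
    unfolding locally_finite_def
  proof
    fix M
    have "ips_nth ((\<lambda>(i, j). ?h i j) x) M = 0" if "x \<notin> insert 1 (set_mset M) \<times> {k}" for x
    proof (cases x)
      case (Pair i j)
      show ?thesis
        by (cases "k = j") (use that q0[of i M] in \<open>auto simp: Pair\<close>)
    qed
    hence "{x. ips_nth ((\<lambda>(i, j). ?h i j) x) M \<noteq> 0} \<subseteq> insert 1 (set_mset M) \<times> {k}" by blast
    thus "finite {x. ips_nth ((\<lambda>(i, j). ?h i j) x) M \<noteq> 0}" by (rule finite_subset) simp
  qed
  have sg: "ips_sum (\<lambda>(i, j). ?g i j) = ?L (w k)"
  proof (rule ips_eqI)
    fix M
    have "{x. ips_nth ((\<lambda>(i, j). ?g i j) x) M \<noteq> 0}
        = (\<lambda>j. (k, j)) ` {j. ips_nth (ips_const (w k j) * q j) M \<noteq> 0}"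
      by (auto split: if_splits)
    thus "ips_nth (ips_sum (\<lambda>(i, j). ?g i j)) M = ips_nth (?L (w k)) M"
      unfolding ips_nth_ips_sum Sum_any.expand_set
      by (simp only:) (subst sum.reindex, auto simp: inj_on_def)
  qed
  have sh: "ips_sum (\<lambda>(i, j). ?h i j) = ?L (w k)"
  proof (rule ips_eqI)
    fix M
    have "{x. ips_nth ((\<lambda>(i, j). ?h i j) x) M \<noteq> 0}
        = (\<lambda>i. (i, k)) ` {i. ips_nth (ips_const (w k i) * q i) M \<noteq> 0}"
      by (auto split: if_splits simp: sym[of k])
    thus "ips_nth (ips_sum (\<lambda>(i, j). ?h i j)) M = ips_nth (?L (w k)) M"
      unfolding ips_nth_ips_sum Sum_any.expand_set
      by (simp only:) (subst sum.reindex, auto simp: inj_on_def sym[of k])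
  qed
  have "\<partial> k (ips_sum (\<lambda>(i, j). ips_const (w i j) * (q i * q j)))
      = ips_sum (\<lambda>x. (\<lambda>(i, j). ?g i j) x + (\<lambda>(i, j). ?h i j) x)"
    unfolding ips_deriv_ips_sum
    by (rule arg_cong[of _ _ ips_sum]) (auto simp: ips_deriv_times ring_distribs)
  also have "\<dots> = ?L (w k) + ?L (w k)" by (simp only: ips_sum_add[OF g h] sg sh)
  finally show ?thesis
    by (intro ips_eqI)
       (simp only: quad_def ips_deriv_linear ips_nth_const_times ips_nth_add, simp)
qed

lemma
  assumes sym: "\<And>k l. w k l = w l k"
  shows const_term_deriv_quad: "const_term (\<partial> k (quad w)) = - w k 1"
    and ips_deriv_deriv_quad: "\<partial> l (\<partial> k (quad w)) = ips_const (w k l)"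
proof -
  have "Sum_any (\<lambda>l. w k l * (if l = 1 then -1 else 0)) = - w k 1"
    by (subst Sum_any.expand_superset[of "{1}"]) (auto split: if_splits)
  thus "const_term (\<partial> k (quad w)) = - w k 1"
    unfolding ips_deriv_quad[OF sym] by simp
  have "ips_sum (\<lambda>j. ips_const (w k j) * (if l = j then 1 else 0)) = ips_const (w k l)"
    by (subst ips_sum_finite_support[of "{l}"]) auto
  thus "\<partial> l (\<partial> k (quad w)) = ips_const (w k l)"
    unfolding ips_deriv_quad[OF sym] ips_deriv_ips_sum by simp
qed

section \<open>The group and its reduced representatives\<close>

lemma fps_uminus_X_compose: "fps_nth a 0 = 0 \<Longrightarrow> (- fps_X) oo a = - (a :: complex fps)"
  by (simp add: fps_compose_uminus)

lemma Gminus_iff: "S \<in> carrier Gminus \<longleftrightarrow> fps_nth S 0 = 1 \<and> (S oo (- fps_X)) * S = 1"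
  by (simp add: Gminus_def)

lemma Gminus_simps [simp]: "x \<otimes>\<^bsub>Gminus\<^esub> y = x * y" "\<one>\<^bsub>Gminus\<^esub> = 1"
  by (simp_all add: Gminus_def)

lemma fps_compose_minus_X_twice: "(S oo (- fps_X)) oo (- fps_X) = (S :: complex fps)"
proof (rule fps_ext)
  show "fps_nth ((S oo (- fps_X)) oo (- fps_X)) n = fps_nth S n" for n
    by (simp add: fps_compose_uminus' mult.assoc[symmetric] power_mult_distrib[symmetric])
qed

lemma Gminus_mult:
  assumes "S \<in> carrier Gminus" "S' \<in> carrier Gminus"
  shows "S * S' \<in> carrier Gminus"
proof -
  have "((S * S') oo (- fps_X)) * (S * S') = ((S oo (- fps_X)) * S) * ((S' oo (- fps_X)) * S')"
    by (simp add: fps_compose_mult_distrib)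
  also have "\<dots> = 1" using assms by (simp only: Gminus_iff mult_1_right)
  finally show ?thesis using assms by (simp add: Gminus_iff)
qed

lemma Gminus_one: "1 \<in> carrier Gminus"
  by (simp add: Gminus_iff)

lemma Gminus_inverse_eq:
  assumes "S \<in> carrier Gminus"
  shows "inverse S = S oo (- fps_X)"
  using assms by (metis Gminus_iff fps_inverse_unique mult.commute)

lemma Gminus_mult_inverse: "S \<in> carrier Gminus \<Longrightarrow> inverse S * S = 1"
  by (simp add: Gminus_iff inverse_mult_eq_1)

lemma Gminus_inverse:
  assumes "S \<in> carrier Gminus"
  shows "inverse S \<in> carrier Gminus"
proof -
  have "((S oo (- fps_X)) oo (- fps_X)) * (S oo (- fps_X)) = 1"
    unfolding fps_compose_minus_X_twice using assms by (simp add: Gminus_iff mult.commute[of S])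
  thus ?thesis
    unfolding Gminus_inverse_eq[OF assms] using assms by (simp only: Gminus_iff fps_compose_nth_0)
qed

lemma comm_group_Gminus: "comm_group Gminus"
proof (rule comm_groupI)
  fix x assume "x \<in> carrier Gminus"
  thus "\<exists>y\<in>carrier Gminus. y \<otimes>\<^bsub>Gminus\<^esub> x = \<one>\<^bsub>Gminus\<^esub>"
    by (intro bexI[of _ "inverse x"]) (simp_all add: Gminus_mult_inverse Gminus_inverse)
qed (simp_all add: Gminus_mult Gminus_one ac_simps)

lemma fps_exp_in_Gminus: "fps_exp c \<in> carrier Gminus"
  by (simp add: Gminus_iff fps_exp_add_mult[symmetric])

lemma normal_Gminus_string: "normal Gminus_string Gminus"
proof -
  interpret comm_group Gminus by (rule comm_group_Gminus)
  have "subgroup Gminus_string Gminus"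
  proof (rule subgroupI)
    fix a b assume "a \<in> Gminus_string" "b \<in> Gminus_string"
    then obtain c d where "a = fps_exp c" "b = fps_exp d" by (auto simp: Gminus_string_def)
    thus "a \<otimes>\<^bsub>Gminus\<^esub> b \<in> Gminus_string"
      by (simp add: Gminus_string_def fps_exp_add_mult[symmetric])
  next
    fix a assume "a \<in> Gminus_string"
    then obtain c where a: "a = fps_exp c" by (auto simp: Gminus_string_def)
    have "inv\<^bsub>Gminus\<^esub> a = fps_exp (- c)"
      by (rule inv_equality) (simp_all add: a fps_exp_in_Gminus fps_exp_add_mult[symmetric])
    thus "inv\<^bsub>Gminus\<^esub> a \<in> Gminus_string" by (simp add: Gminus_string_def)
  qed (auto simp: Gminus_string_def fps_exp_in_Gminus)
  thus ?thesis by (simp add: normal_iff_subgroup)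
qed

section \<open>Exponentials, logarithms and parity\<close>

lemma fps_exp_compose_add_inverse:
  assumes "fps_nth a 0 = 0"
  shows "(fps_exp 1 oo - a) * (fps_exp 1 oo a) = (1 :: complex fps)"
proof -
  \<comment> \<open>The sign is moved from the inner series to \<open>- fps_X\<close>, so that the
    product law of \<open>fps_exp\<close> applies before composing with \<open>a\<close>.\<close>
  have "fps_exp 1 oo - a = (fps_exp 1 oo - fps_X) oo a"
    using assms by (simp add: fps_compose_assoc[symmetric] fps_uminus_X_compose del: fps_fps_exp_compose_minus)
  hence "fps_exp 1 oo - a = fps_exp (-1) oo a" by simp
  hence "(fps_exp 1 oo - a) * (fps_exp 1 oo a) = (fps_exp (-1) * fps_exp 1) oo a"
    using assms by (simp only: fps_compose_mult_distrib)
  thus ?thesis by (simp add: fps_exp_add_mult[symmetric])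
qed

text \<open>\<open>fps_ln 1\<close> is the compositional inverse of \<open>fps_exp 1 - 1\<close> and
  recovers the exponent.\<close>

lemma fps_exp_compose_inject:
  assumes "fps_nth a 0 = 0" "fps_nth b 0 = 0" "fps_exp 1 oo a = fps_exp 1 oo b"
  shows "a = (b :: complex fps)"
proof -
  have *: "fps_ln 1 oo ((fps_exp 1 - 1) oo c) = c" if "fps_nth c 0 = 0" for c :: "complex fps"
  proof -
    have "fps_ln 1 oo ((fps_exp 1 - 1) oo c) = (fps_inv (fps_exp 1 - 1) oo (fps_exp 1 - 1)) oo c"
      using that by (simp add: fps_compose_assoc fps_ln_fps_exp_inv)
    also have "fps_inv (fps_exp 1 - 1) oo (fps_exp 1 - 1) = (fps_X :: complex fps)"
      by (rule fps_inv) simp_all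
    finally show ?thesis using that by simp
  qed
  have "(fps_exp 1 - 1) oo a = (fps_exp 1 - 1) oo b"
    using assms(3) by (simp add: fps_compose_sub_distrib)
  thus ?thesis using *[OF assms(1)] *[OF assms(2)] by metis
qed

text \<open>S(-z) S(z) = 1 says that log S is odd, and log S has the same linear coefficient as S;
  the exponents allowed in \<open>reduced\<close> are what remains. In this algebraic form closure
  under products and inverses is easy.\<close>

lemma reduced_iff: "reduced S \<longleftrightarrow> S \<in> carrier Gminus \<and> fps_nth S 1 = 0"
proof
  assume "reduced S"
  then obtain a where a: "\<And>n. fps_nth a n \<noteq> 0 \<Longrightarrow> odd n \<and> n \<ge> 3" and S: "S = fps_exp 1 oo a"
    by (auto simp: reduced_def)
  have a0: "fps_nth a 0 = 0" "fps_nth a 1 = 0" using a[of 0] a[of 1] by auto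
  have "a oo - fps_X = - a"
    unfolding fps_compose_uminus' fps_eq_iff using a by (auto simp: minus_one_power_iff)
  hence "S oo - fps_X = fps_exp 1 oo - a"
    using a0 by (simp add: S fps_compose_assoc[symmetric])
  moreover have "fps_nth S 1 = 0"
    using a0 by (simp add: S fps_compose_nth)
  ultimately show "S \<in> carrier Gminus \<and> fps_nth S 1 = 0"
    using a0 fps_exp_compose_add_inverse[OF a0(1)] by (simp add: Gminus_iff S)
next
  assume S: "S \<in> carrier Gminus \<and> fps_nth S 1 = 0"
  \<comment> \<open>\<open>fps_ln 1\<close> is the series of log(1 + x), so this is log S.\<close>
  define a where "a = fps_ln 1 oo (S - 1)"
  have S0: "fps_nth (S - 1) 0 = 0" "fps_nth S 1 = 0" using S by (simp_all add: Gminus_iff)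
  have a0: "fps_nth a 0 = 0" by (simp add: a_def)
  have "(fps_exp 1 - 1) oo a = ((fps_exp 1 - 1) oo fps_ln 1) oo (S - 1)"
    using S0 unfolding a_def by (intro fps_compose_assoc) simp_all
  also have "\<dots> = S - 1"
    using S0 by (simp add: fps_ln_fps_exp_inv fps_inv_right)
  finally have eS: "fps_exp 1 oo a = S"
    by (simp add: fps_compose_sub_distrib)
  have "fps_exp 1 oo (a oo - fps_X) = S oo - fps_X"
    using a0 by (simp add: eS fps_compose_assoc)
  also have "\<dots> = fps_exp 1 oo - a"
  proof -
    \<comment> \<open>Both left factors are inverse to \<open>S\<close>, hence equal by
      cancellation.\<close>
    have "(S oo - fps_X) * S = (fps_exp 1 oo - a) * S"
      using S fps_exp_compose_add_inverse[OF a0] by (simp add: eS Gminus_iff)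
    moreover have "S \<noteq> 0" using S by (auto simp: Gminus_iff)
    ultimately show ?thesis by simp
  qed
  finally have "fps_exp 1 oo (a oo - fps_X) = fps_exp 1 oo - a" .
  hence odd: "a oo - fps_X = - a"
    by (rule fps_exp_compose_inject[rotated -1]) (simp_all add: a0)
  have "fps_nth a 1 = 0"
    using S0 by (simp add: a_def fps_compose_nth fps_ln_nth)
  moreover have "fps_nth a n = 0" if "even n" for n
  proof -
    have "fps_nth (a oo - fps_X) n = fps_nth (- a) n" by (simp only: odd)
    thus ?thesis using that by (simp add: fps_compose_uminus')
  qed
  moreover have "n \<ge> 3" if "odd n" "n \<noteq> 1" for n :: nat
    using that by (cases "n = 2") (auto elim: oddE)
  ultimately have "\<forall>n. fps_nth a n \<noteq> 0 \<longrightarrow> odd n \<and> n \<ge> 3" by metis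
  thus "reduced S"
    unfolding reduced_def using eS by metis
qed

section \<open>Coset representatives\<close>

lemma fps_mult_nth_one: "fps_nth (S * S') 1 = fps_nth S 0 * fps_nth S' 1 + fps_nth S 1 * fps_nth (S' :: complex fps) 0"
  by (simp add: fps_mult_nth)

lemma Gminus_nth_0: "S \<in> carrier Gminus \<Longrightarrow> fps_nth S 0 = 1"
  by (simp add: Gminus_iff)

lemma reduced_mult: "reduced S \<Longrightarrow> reduced S' \<Longrightarrow> reduced (S * S')"
  unfolding reduced_iff fps_mult_nth_one by (simp add: Gminus_mult)

lemma reduced_one: "reduced 1"
  by (simp add: reduced_iff Gminus_one)

lemma reduced_inverse:
  assumes "reduced S"
  shows "reduced (inverse S)"
proof -
  have S: "S \<in> carrier Gminus" "fps_nth S 1 = 0" using assms by (simp_all add: reduced_iff)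
  have "fps_nth (inverse S) 1 = 0"
    unfolding Gminus_inverse_eq[OF S(1)] fps_compose_uminus' using S(2) by simp
  thus ?thesis unfolding reduced_iff using S(1) by (simp add: Gminus_inverse)
qed

text \<open>Multiplying by \<open>fps_exp c\<close> adds \<open>c\<close> to the linear coefficient,
  as the constant terms are 1; exactly one element of the coset therefore has linear coefficient
  0.\<close>

lemma rep_rcoset:
  assumes "S \<in> carrier Gminus"
  shows "rep (Gminus_string #>\<^bsub>Gminus\<^esub> S) = fps_exp (- fps_nth S 1) * S"
  unfolding rep_def
proof (rule the_equality)
  have S0: "fps_nth S 0 = 1" using assms by (rule Gminus_nth_0)
  have "fps_exp (- fps_nth S 1) * S \<in> Gminus_string #>\<^bsub>Gminus\<^esub> S"
    by (auto simp: r_coset_def Gminus_string_def)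
  moreover have "fps_nth (fps_exp (- fps_nth S 1) * S) 1 = 0"
    unfolding fps_mult_nth_one using S0 by simp
  ultimately show "fps_exp (- fps_nth S 1) * S \<in> Gminus_string #>\<^bsub>Gminus\<^esub> S \<and> reduced (fps_exp (- fps_nth S 1) * S)"
    unfolding reduced_iff using assms by (simp add: Gminus_mult fps_exp_in_Gminus)
  fix P assume P: "P \<in> Gminus_string #>\<^bsub>Gminus\<^esub> S \<and> reduced P"
  then obtain c where c: "P = fps_exp c * S" by (auto simp: r_coset_def Gminus_string_def)
  have "fps_nth P 1 = 0" using P by (simp add: reduced_iff)
  moreover have "fps_nth P 1 = c + fps_nth S 1" unfolding c fps_mult_nth_one using S0 by simp
  ultimately have "c = - fps_nth S 1" by (simp add: eq_neg_iff_add_eq_0)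
  thus "P = fps_exp (- fps_nth S 1) * S" by (simp add: c)
qed

lemma Gminus'_carrier_iff: "C \<in> carrier Gminus' \<longleftrightarrow> (\<exists>S\<in>carrier Gminus. C = Gminus_string #>\<^bsub>Gminus\<^esub> S)"
  by (auto simp: Gminus'_def FactGroup_def RCOSETS_def)

lemma Gminus'_one: "\<one>\<^bsub>Gminus'\<^esub> = Gminus_string"
  by (simp add: Gminus'_def FactGroup_def)

lemma group_Gminus': "group Gminus'"
  unfolding Gminus'_def by (rule normal.factorgroup_is_group[OF normal_Gminus_string])

lemma reduced_rep:
  assumes "C \<in> carrier Gminus'"
  shows "reduced (rep C)"
proof -
  obtain S where S: "S \<in> carrier Gminus" "C = Gminus_string #>\<^bsub>Gminus\<^esub> S"
    using assms by (auto simp: Gminus'_carrier_iff)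
  show ?thesis
    unfolding S(2) rep_rcoset[OF S(1)] reduced_iff fps_mult_nth_one
    using S(1) by (simp add: Gminus_mult fps_exp_in_Gminus Gminus_nth_0)
qed

text \<open>The linear coefficient is additive on series with constant term 1, so the two
  normalising exponentials multiply to the one for the product.\<close>

lemma rep_mult:
  assumes "C \<in> carrier Gminus'" "D \<in> carrier Gminus'"
  shows "rep (C \<otimes>\<^bsub>Gminus'\<^esub> D) = rep C * rep D"
proof -
  obtain S S' where S: "S \<in> carrier Gminus" "C = Gminus_string #>\<^bsub>Gminus\<^esub> S"
    and S': "S' \<in> carrier Gminus" "D = Gminus_string #>\<^bsub>Gminus\<^esub> S'"
    using assms by (auto simp: Gminus'_carrier_iff)
  have "C \<otimes>\<^bsub>Gminus'\<^esub> D = Gminus_string #>\<^bsub>Gminus\<^esub> (S * S')"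
    using normal.rcos_sum[OF normal_Gminus_string S(1) S'(1)]
    by (simp add: Gminus'_def FactGroup_def S(2) S'(2))
  moreover have "- fps_nth (S * S') 1 = - fps_nth S 1 + - fps_nth S' 1"
    unfolding fps_mult_nth_one using S(1) S'(1) by (simp add: Gminus_nth_0)
  ultimately show ?thesis
    using S S' by (simp only: rep_rcoset Gminus_mult fps_exp_add_mult) (simp add: ac_simps)
qed

lemma rep_one: "rep \<one>\<^bsub>Gminus'\<^esub> = 1"
proof -
  interpret normal Gminus_string Gminus by (rule normal_Gminus_string)
  have "\<one>\<^bsub>Gminus'\<^esub> = Gminus_string #>\<^bsub>Gminus\<^esub> 1"
    using coset_mult_one[OF subset] by (simp add: Gminus'_one)
  thus ?thesis by (simp add: rep_rcoset[OF Gminus_one])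
qed

lemma rep_eq_1D:
  assumes "C \<in> carrier Gminus'" "rep C = 1"
  shows "C = \<one>\<^bsub>Gminus'\<^esub>"
proof -
  interpret normal Gminus_string Gminus by (rule normal_Gminus_string)
  obtain S where S: "S \<in> carrier Gminus" "C = Gminus_string #>\<^bsub>Gminus\<^esub> S"
    using assms by (auto simp: Gminus'_carrier_iff)
  have "1 = fps_exp (- fps_nth S 1) * S" using assms(2) S by (simp add: rep_rcoset)
  hence "fps_exp (fps_nth S 1) = (fps_exp (fps_nth S 1) * fps_exp (- fps_nth S 1)) * S"
    by (metis mult.assoc mult_1_right)
  hence "S = fps_exp (fps_nth S 1)" by (simp add: fps_exp_add_mult[symmetric])
  hence "S \<in> Gminus_string" by (metis Gminus_string_def rangeI)
  thus ?thesis using S by (simp add: Gminus'_one coset_join2 subgroup_axioms)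
qed

section \<open>The action\<close>

definition W_rel :: "(nat \<Rightarrow> nat \<Rightarrow> complex) \<Rightarrow> (nat \<Rightarrow> nat \<Rightarrow> complex) \<Rightarrow> bool" where
  "W_rel A w \<longleftrightarrow> (\<forall>k l. (if k = 0 then 0 else w (k - 1) l) + (if l = 0 then 0 else w k (l - 1)) = A k l)"

text \<open>Row 0 is read off from the relation at \<open>(0, l + 1)\<close>; the relation at
  \<open>(k + 1, l + 1)\<close> then expresses row \<open>k + 1\<close> through row
  \<open>k\<close>.\<close>

lemma W_rel_unique:
  assumes "W_rel A u" "W_rel A v"
  shows "u = v"
proof -
  have "u k l = v k l" for k l
  proof (induction k arbitrary: l)
    case 0
    show ?case
      using assms[unfolded W_rel_def, THEN spec[of _ 0], THEN spec[of _ "Suc l"]] by simp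
  next
    case (Suc k)
    show ?case
      using assms[unfolded W_rel_def, THEN spec[of _ "Suc k"], THEN spec[of _ "Suc l"]] Suc[of "Suc l"]
      by (simp, metis add_left_imp_eq)
  qed
  thus ?thesis by blast
qed

text \<open>The hypothesis says that the series with coefficients \<open>A\<close> vanishes at
  z^{-1} = -w^{-1}. The witness unfolds \<open>w k l = A (k + 1) l - w (k + 1) (l - 1)\<close> down
  to \<open>l = 0\<close>.\<close>

lemma W_rel_exists:
  assumes "\<And>m. (\<Sum>j\<le>m. (-1) ^ j * A j (m - j)) = 0"
  shows "W_rel A (\<lambda>k l. \<Sum>j\<le>l. (-1) ^ j * A (k + 1 + j) (l - j))"
  unfolding W_rel_def
proof (intro allI)
  fix k l
  let ?w = "\<lambda>k l. \<Sum>j\<le>l. (-1) ^ j * A (k + 1 + j) (l - j)"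
  let ?v = "\<lambda>k l. \<Sum>j\<le>l. (-1) ^ j * A (k + j) (l - j)"
  \<comment> \<open>For \<open>k = 0\<close> the boundary value 0 equals the sum by the hypothesis;
    for \<open>k > 0\<close> both sides are the same sum.\<close>
  have 1: "(if k = 0 then 0 else ?w (k - 1) l) = ?v k l"
    using assms[of l] by (cases k) auto
  have 2: "?v k l = A k l - (if l = 0 then 0 else ?w k (l - 1))"
  proof (cases l)
    case (Suc l')
    have "?v k l = A k l + (\<Sum>j\<le>l'. (-1) ^ Suc j * A (k + Suc j) (l - Suc j))"
      unfolding Suc by (subst sum.atMost_Suc_shift) simp
    thus ?thesis by (simp add: Suc sum_negf)
  qed simp
  show "(if k = 0 then 0 else ?w (k - 1) l) + (if l = 0 then 0 else ?w k (l - 1)) = A k l"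
    unfolding 1 2 by simp
qed

definition W_rhs :: "complex fps \<Rightarrow> nat \<Rightarrow> nat \<Rightarrow> complex" where
  "W_rhs R k l = fps_nth R k * fps_nth R l - (if k = 0 \<and> l = 0 then 1 else 0)"

lemma in_w_fps_X: "in_w fps_X = fps_X"
  by (rule fps_ext) (simp add: in_w_def fps_X_def)

lemma in_w_mult: "in_w (a * b) = in_w a * in_w b"
  by (rule fps_ext, rule fps_ext) (simp add: in_w_def fps_mult_nth fps_sum_nth)

lemma in_z_mult: "in_z (a * b) = in_z a * in_z b"
  by (simp add: in_z_def)

lemma nth_in_w_in_z: "fps_nth (fps_nth (in_w a * in_z b) l) k = fps_nth a l * fps_nth b k"
  by (simp add: in_w_def in_z_def)

text \<open>Comparison of coefficients; the outer index \<open>l\<close> counts powers of w^{-1},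
  the inner index \<open>k\<close> powers of z^{-1}.\<close>

lemma W_eqn_iff:
  "(in_z fps_X + in_w fps_X) * V = in_w R * in_z R - 1
     \<longleftrightarrow> W_rel (W_rhs R) (\<lambda>k l. fps_nth (fps_nth V l) k)"
proof -
  have "fps_nth (fps_nth ((in_z fps_X + in_w fps_X) * V) l) k
      = (if k = 0 then 0 else fps_nth (fps_nth V l) (k - 1))
        + (if l = 0 then 0 else fps_nth (fps_nth V (l - 1)) k)" for k l
    by (simp add: in_w_fps_X in_z_def distrib_right)
  moreover have "fps_nth (fps_nth (in_w R * in_z R - 1) l) k = W_rhs R k l" for k l
    unfolding fps_sub_nth nth_in_w_in_z by (simp add: W_rhs_def)
  ultimately show ?thesis
    unfolding fps_eq_iff[of _ "in_w R * in_z R - 1"] fps_eq_iff[of "fps_nth _ _"] W_rel_def by auto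
qed

lemma W_series_unique:
  assumes "W_rel (W_rhs R) (\<lambda>k l. fps_nth (fps_nth V l) k)" "W_rel (W_rhs R) (\<lambda>k l. fps_nth (fps_nth V' l) k)"
  shows "V = V'"
proof (rule fps_ext, rule fps_ext)
  show "fps_nth (fps_nth V l) k = fps_nth (fps_nth V' l) k" for k l
    using fun_cong[OF fun_cong[OF W_rel_unique[OF assms]], of l k] .
qed

lemma W_series_eqI:
  assumes "(in_z fps_X + in_w fps_X) * V = in_w (inverse S) * in_z (inverse S) - 1"
  shows "W_series S = V"
  unfolding W_series_def
  by (rule the_equality, rule assms) (use W_series_unique assms W_eqn_iff in blast)

text \<open>At z^{-1} = -w^{-1} the numerator becomes R(-z) R(z) - 1 with R = S^{-1}, which is zero
  because \<open>inverse S\<close> lies in \<open>Gminus\<close>. This justifies the definite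
  description in \<open>W_series\<close>.\<close>

lemma W_series_eqn:
  assumes "S \<in> carrier Gminus"
  shows "(in_z fps_X + in_w fps_X) * W_series S = in_w (inverse S) * in_z (inverse S) - 1"
proof -
  let ?R = "inverse S"
  have R: "(?R oo - fps_X) * ?R = 1" using Gminus_inverse[OF assms] by (simp only: Gminus_iff)
  have "W_rel (W_rhs ?R) (\<lambda>k l. \<Sum>j\<le>l. (-1) ^ j * W_rhs ?R (k + 1 + j) (l - j))"
  proof (rule W_rel_exists)
    fix m
    have "(\<Sum>j\<le>m. (-1) ^ j * (fps_nth ?R j * fps_nth ?R (m - j))) = fps_nth ((?R oo - fps_X) * ?R) m"
      by (simp add: fps_mult_nth fps_compose_uminus' mult.assoc atLeast0AtMost)
    also have "\<dots> = (if m = 0 then 1 else 0)" by (simp add: R)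
    moreover have "(\<Sum>j\<le>m. (-1) ^ j * (if j = 0 \<and> m - j = 0 then 1 else 0 :: complex))
        = (\<Sum>j\<le>m. if j = 0 then (if m = 0 then 1 else 0) else 0)"
      by (intro sum.cong) auto
    ultimately show "(\<Sum>j\<le>m. (-1) ^ j * W_rhs ?R j (m - j)) = 0"
      by (simp add: W_rhs_def right_diff_distrib sum_subtractf)
  qed
  then obtain w where w: "W_rel (W_rhs ?R) w" ..
  define V where "V = Abs_fps (\<lambda>l. Abs_fps (\<lambda>k. w k l))"
  have eq: "(in_z fps_X + in_w fps_X) * V = in_w ?R * in_z ?R - 1"
    unfolding W_eqn_iff using w by (simp add: V_def)
  thus ?thesis by (simp only: W_series_eqI[OF eq])
qed

lemma W_rel_W:
  assumes "S \<in> carrier Gminus"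
  shows "W_rel (W_rhs (inverse S)) (W S)"
proof -
  have "W S = (\<lambda>k l. fps_nth (fps_nth (W_series S) l) k)" by (intro ext) (simp add: W_def)
  thus ?thesis using W_series_eqn[OF assms] by (simp add: W_eqn_iff)
qed

text \<open>\<open>W_rhs\<close> is symmetric, so the transpose solves the same relation and
  uniqueness applies.\<close>

lemma W_sym:
  assumes "S \<in> carrier Gminus"
  shows "W S k l = W S l k"
proof -
  have "W_rel (W_rhs (inverse S)) (\<lambda>k l. W S l k)"
    unfolding W_rel_def
  proof (intro allI)
    show "(if k = 0 then 0 else W S l (k - 1)) + (if l = 0 then 0 else W S (l - 1) k) = W_rhs (inverse S) k l" for k l
      using W_rel_W[OF assms, unfolded W_rel_def, THEN spec[of _ l], THEN spec[of _ k]]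
      by (simp only: W_rhs_def add.commute mult.commute conj_commute)
  qed
  from fun_cong[OF fun_cong[OF W_rel_unique[OF W_rel_W[OF assms] this]], of k l] show ?thesis .
qed

text \<open>The relation at \<open>(k + 1, 0)\<close> has a single term on the left. This column
  supplies the correction in (TRR) and detects \<open>S\<close> in the freeness argument.\<close>

lemma W_k_0:
  assumes "S \<in> carrier Gminus"
  shows "W S k 0 = fps_nth (inverse S) (Suc k)"
  using W_rel_W[OF assms, unfolded W_rel_def W_rhs_def, THEN spec[of _ "Suc k"], THEN spec[of _ 0]]
    Gminus_nth_0[OF assms] by simp

lemma W_one: "W 1 k l = 0"
proof -
  have "W_rel (W_rhs 1) (\<lambda>k l. 0)" by (auto simp: W_rel_def W_rhs_def)
  moreover have "W_rel (W_rhs 1) (W 1)" using W_rel_W[OF Gminus_one] by simp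
  ultimately show ?thesis using W_rel_unique by metis
qed

text \<open>The numerator for the product is R(w) R(z) times the numerator for \<open>S'\<close>
  plus the numerator for \<open>S\<close>. Division gives a cocycle rule that matches substitution
  into a quadratic form.\<close>

lemma W_mult:
  assumes "S \<in> carrier Gminus" "S' \<in> carrier Gminus"
  shows "W (S * S') k l
    = (\<Sum>i\<le>k. \<Sum>j\<le>l. fps_nth (inverse S) (k - i) * fps_nth (inverse S) (l - j) * W S' i j) + W S k l"
proof -
  let ?R = "inverse S" and ?R' = "inverse S'" and ?P = "in_z fps_X + in_w fps_X"
  have "?P * (in_w ?R * in_z ?R * W_series S' + W_series S)
      = in_w ?R * in_z ?R * (?P * W_series S') + ?P * W_series S"
    by (simp only: ring_distribs ac_simps)
  also have "\<dots> = in_w ?R * in_z ?R * (in_w ?R' * in_z ?R' - 1) + (in_w ?R * in_z ?R - 1)"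
    by (simp only: W_series_eqn assms)
  also have "\<dots> = in_w (?R * ?R') * in_z (?R * ?R') - 1"
    by (simp add: in_w_mult in_z_mult right_diff_distrib ac_simps)
  also have "?R * ?R' = inverse (S * S')" by (simp add: fps_inverse_mult)
  finally have "W_series (S * S') = in_w ?R * in_z ?R * W_series S' + W_series S"
    by (rule W_series_eqI)
  hence "W (S * S') k l = fps_nth (fps_nth (in_w ?R * (in_z ?R * W_series S')) l) k + W S k l"
    by (simp add: W_def mult.assoc)
  also have "fps_nth (fps_nth (in_w ?R * (in_z ?R * W_series S')) l) k
      = (\<Sum>j=0..l. fps_nth ?R j * (\<Sum>i=0..k. fps_nth ?R i * W S' (k - i) (l - j)))"
  proof -
    have "fps_nth (in_w ?R * (in_z ?R * W_series S')) l
        = (\<Sum>j=0..l. fps_const (fps_nth ?R j) * (?R * fps_nth (W_series S') (l - j)))"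
      unfolding fps_mult_nth[of "in_w ?R"] by (simp add: in_w_def in_z_def)
    thus ?thesis by (simp add: fps_sum_nth fps_mult_nth[of ?R] W_def)
  qed
  \<comment> \<open>Both convolution indices are reversed to obtain the coefficients R_{k-i} of the
    chain rule.\<close>
  also have "\<dots> = (\<Sum>j\<le>l. fps_nth ?R (l - j) * (\<Sum>i\<le>k. fps_nth ?R (k - i) * W S' i j))"
  proof -
    have rev: "(\<Sum>i=0..n. f i) = (\<Sum>i\<le>n. f (n - i))" for f :: "nat \<Rightarrow> complex" and n
      by (rule sum.reindex_bij_witness[of _ "\<lambda>i. n - i" "\<lambda>i. n - i"]) auto
    show ?thesis by (simp add: rev cong: sum.cong_simp)
  qed
  also have "\<dots> = (\<Sum>i\<le>k. \<Sum>j\<le>l. fps_nth ?R (k - i) * fps_nth ?R (l - j) * W S' i j)"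
    by (subst sum.swap) (simp add: sum_distrib_left ac_simps)
  finally show ?thesis .
qed

section \<open>The operators \<open>S_hat\<close>\<close>

lemma reducedD:
  assumes "reduced S"
  shows "S \<in> carrier Gminus" "fps_nth (inverse S) 0 = 1" "fps_nth (inverse S) 1 = 0"
  using assms reduced_inverse[OF assms] by (auto simp: reduced_iff Gminus_nth_0)

lemma S_hat_eq:
  assumes "reduced S"
  shows "S_hat S F = lin_subst (inverse S) F + quad (W S)"
proof -
  let ?R = "inverse S"
  note R = reducedD(2,3)[OF assms]
  have "shifted_q S i + (if i = 1 then 1 else 0) = lin_form ?R i" for i
  proof (rule ips_eq_derivI)
    have "const_term (shifted_q S i) = Sum_any (\<lambda>n. fps_nth ?R n * (if i + n = 1 then -1 else 0))"
      by (simp add: shifted_q_def)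
    also have "\<dots> = (if i \<le> 1 then - fps_nth ?R (1 - i) else 0)"
      by (subst Sum_any.expand_superset[of "{1 - i}"]) (auto split: if_splits)
    \<comment> \<open>R_1 = 0 removes the constant term at \<open>i = 0\<close>; at
      \<open>i = 1\<close> it is -R_0 = -1, which the dilaton shift cancels.\<close>
    also have "\<dots> = (if i = 1 then -1 else 0)"
    proof -
      consider "i = 0" | "i = 1" | "i > 1" by linarith
      thus ?thesis using R by cases auto
    qed
    finally show "const_term (shifted_q S i + (if i = 1 then 1 else 0)) = const_term (lin_form ?R i)"
      by simp
  next
    fix k
    have "\<partial> k (shifted_q S i + (if i = 1 then 1 else 0))
        = ips_sum (\<lambda>n. ips_const (fps_nth ?R n) * (if k = i + n then 1 else 0))"
      by (simp add: shifted_q_def ips_deriv_ips_sum)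
    thus "\<partial> k (shifted_q S i + (if i = 1 then 1 else 0)) = \<partial> k (lin_form ?R i)"
      unfolding lin_form_def ips_deriv_ips_sum by simp
  qed
  thus ?thesis by (simp add: S_hat_def lin_subst_def quad_def)
qed

lemma S_hat_one: "S_hat 1 F = F"
proof -
  note sym = W_sym[OF Gminus_one]
  have "quad (W 1) = 0"
    by (rule ips_eq_second_derivI)
       (simp_all add: const_term_quad const_term_deriv_quad[OF sym] ips_deriv_deriv_quad[OF sym] W_one
          del: ips_nth_deriv)
  thus ?thesis by (simp add: S_hat_eq reduced_one)
qed

text \<open>The substitutions compose by \<open>lin_subst_lin_subst\<close>, and the quadratic terms
  combine by the cocycle rule \<open>W_mult\<close>.\<close>

lemma S_hat_mult:
  assumes S: "reduced S" and S': "reduced S'"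
  shows "S_hat S (S_hat S' F) = S_hat (S * S') F"
proof -
  let ?R = "inverse S"
  note G = reducedD(1)[OF S] and G' = reducedD(1)[OF S'] and R = reducedD(2,3)[OF S]
  note Q = const_term_quad const_term_deriv_quad[OF W_sym] ips_deriv_deriv_quad[OF W_sym]
  \<comment> \<open>Constant terms of first derivatives involve column 1 only, where R_0 = 1 and R_1
    = 0 reduce the sum over \<open>j \<le> 1\<close> to \<open>j = 1\<close>.\<close>
  have W1: "W (S * S') k 1 = (\<Sum>i\<le>k. fps_nth ?R (k - i) * W S' i 1) + W S k 1" for k
    unfolding W_mult[OF G G'] using R by simp
  have W11: "W (S * S') 1 1 = W S' 1 1 + W S 1 1"
    unfolding W1 using R by simp
  have "lin_subst ?R (quad (W S')) + quad (W S) = quad (W (S * S'))" (is "?l = ?r")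
  proof (rule ips_eq_second_derivI)
    show "const_term ?l = const_term ?r"
      by (simp only: ips_nth_simps const_term_lin_subst Q W11) (simp add: add_divide_distrib)
  next
    fix k
    show "const_term (\<partial> k ?l) = const_term (\<partial> k ?r)"
      by (simp only: ips_deriv_linear ips_deriv_lin_subst ips_nth_add ips_nth_sum ips_nth_const_times const_term_lin_subst
          Q G G' Gminus_mult W1) (simp add: sum_negf)
    fix l
    have "\<partial> l (\<partial> k ?l) = ips_const ((\<Sum>i\<le>k. \<Sum>j\<le>l. fps_nth ?R (k - i) * fps_nth ?R (l - j) * W S' i j) + W S k l)"
      by (simp only: ips_deriv_linear ips_deriv_lin_subst ips_deriv_sum Q G G' lin_subst_const sum_distrib_left
          ips_const_add ips_const_sum ips_const_mult mult.assoc)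
    thus "\<partial> l (\<partial> k ?l) = \<partial> l (\<partial> k ?r)"
      by (simp only: W_mult[OF G G'] Q Gminus_mult[OF G G'])
  qed
  thus ?thesis
    using S S' by (simp add: S_hat_eq reduced_mult lin_subst_lin_subst fps_inverse_mult add.assoc)
qed

section \<open>Invariance of the three axioms\<close>

lemma DE_iff: "DE F \<longleftrightarrow> euler 0 F = ips_const 2 * F"
  by (simp add: DE_def euler_def two_ips_eq)

lemma SE_iff: "SE F \<longleftrightarrow> euler 1 F = - (ips_const (1/2) * (q 0)\<^sup>2)"
  by (simp add: SE_def euler_def)

text \<open>\<open>euler 0\<close> commutes with the substitution, and \<open>quad (W S)\<close> is
  homogeneous of degree 2 in \<open>q\<close>.\<close>

lemma DE_S_hat:
  assumes S: "reduced S" and F: "DE F"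
  shows "DE (S_hat S F)"
proof -
  note G = reducedD(1)[OF S]
  note Q = const_term_quad const_term_deriv_quad[OF W_sym[OF G]] ips_deriv_deriv_quad[OF W_sym[OF G]]
  have "euler 0 (quad (W S)) = ips_const 2 * quad (W S)" (is "?l = ?r")
  proof (rule ips_eq_second_derivI)
    show "const_term ?l = const_term ?r"
      by (subst const_term_euler, simp, simp only: Q ips_nth_const_times) simp
    fix k
    show "const_term (\<partial> k ?l) = const_term (\<partial> k ?r)"
      unfolding ips_deriv_euler ips_nth_add
      by (subst const_term_euler, simp) (simp add: Q del: ips_nth_deriv)
    fix l
    have "\<partial> l (\<partial> k ?l) = ips_const (W S k l) + ips_const (W S k l)"
      by (simp add: ips_deriv_euler Q)
    also have "\<dots> = \<partial> l (\<partial> k ?r)"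
      unfolding ips_deriv_linear Q
      by (rule ips_eqI) (simp only: ips_nth_simps ips_nth_const_times, simp)
    finally show "\<partial> l (\<partial> k ?l) = \<partial> l (\<partial> k ?r)" .
  qed
  thus ?thesis
    using F reducedD(2,3)[OF S] by (simp add: DE_iff S_hat_eq[OF S] euler_add lin_subst_euler[symmetric] ring_distribs)
qed

text \<open>The string field turns the quadratic term into half the difference of the squares of (R
  q)_0 and q_0, which corrects the substituted right-hand side.\<close>

lemma SE_S_hat:
  assumes S: "reduced S" and F: "SE F"
  shows "SE (S_hat S F)"
proof -
  let ?R = "inverse S"
  note G = reducedD(1)[OF S] and R = reducedD(2,3)[OF S]
  note Q = const_term_quad const_term_deriv_quad[OF W_sym[OF G]] ips_deriv_deriv_quad[OF W_sym[OF G]]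
  have sym: "W_rhs ?R k l = W_rhs ?R l k" for k l by (auto simp: W_rhs_def)
  note A = const_term_quad const_term_deriv_quad[OF sym] ips_deriv_deriv_quad[OF sym]
  note rel = W_rel_W[OF G, unfolded W_rel_def, rule_format]
  \<comment> \<open>Second derivatives of the left side are W_{k-1,l} + W_{k,l-1}, so this is the
    defining relation of \<open>W\<close>.\<close>
  have "euler 1 (quad (W S)) = quad (W_rhs ?R)" (is "?l = ?r")
  proof (rule ips_eq_second_derivI)
    show "const_term ?l = const_term ?r"
      using rel[of 1 1] W_sym[OF G, of 0 1]
      by (subst const_term_euler) (simp_all add: Q A mult.commute[of _ 2] del: ips_nth_deriv)
    fix k
    show "const_term (\<partial> k ?l) = const_term (\<partial> k ?r)"
      unfolding ips_deriv_euler ips_nth_add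
      by (subst const_term_euler)
         (simp_all add: Q A rel[of k 1, symmetric, unfolded One_nat_def] del: ips_nth_deriv)
    show "\<partial> l (\<partial> k ?l) = \<partial> l (\<partial> k ?r)" for l
      by (rule ips_eqI) (use rel[of k l] in \<open>auto simp: ips_deriv_euler Q A add.commute simp del: ips_nth_deriv\<close>)
  qed
  \<comment> \<open>\<open>W_rhs\<close> is the rank-one matrix R_k R_l minus the unit at (0,0). As
    R_1 = 0, the shift in \<open>q 1\<close> does not disturb the linear form with coefficients
    R_k.\<close>
  also have "quad (W_rhs ?R) = ips_const (1/2) * ((lin_subst ?R (q 0))\<^sup>2 - (q 0)\<^sup>2)" (is "?l = ?r")
  proof -
    have dT: "\<partial> k (lin_subst ?R (q 0)) = ips_const (fps_nth ?R k)" for k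
    proof -
      have "\<partial> k (lin_subst ?R (q 0)) = (\<Sum>i\<le>k. if i = 0 then ips_const (fps_nth ?R k) else 0)"
        unfolding ips_deriv_lin_subst by (intro sum.cong refl) auto
      thus ?thesis by simp
    qed
    have dq: "\<partial> k (q 0) = ips_const (if k = 0 then 1 else 0)" for k by simp
    show ?thesis
    proof (rule ips_eq_second_derivI)
      show "const_term ?l = const_term ?r"
        using R by (simp add: A W_rhs_def power2_eq_square)
      fix k
      have dr: "\<partial> k ?r = ips_const (fps_nth ?R k) * lin_subst ?R (q 0) - ips_const (if k = 0 then 1 else 0) * q 0"
        by (simp only: ips_deriv_linear ips_deriv_square dT dq right_diff_distrib ips_const_half_double)
      show "const_term (\<partial> k ?l) = const_term (\<partial> k ?r)"
        unfolding dr using R by (simp add: A W_rhs_def del: ips_nth_deriv)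
      show "\<partial> l (\<partial> k ?l) = \<partial> l (\<partial> k ?r)" for l
        unfolding dr unfolding ips_deriv_linear dT dq A by (rule ips_eqI) (auto simp: W_rhs_def)
    qed
  qed
  finally have "euler 1 (S_hat S F) = lin_subst ?R (euler 1 F) + ips_const (1/2) * ((lin_subst ?R (q 0))\<^sup>2 - (q 0)\<^sup>2)"
    using R by (simp add: S_hat_eq[OF S] euler_add lin_subst_euler)
  also have "\<dots> = - (ips_const (1/2) * (q 0)\<^sup>2)"
    using F by (simp add: SE_iff power2_eq_square lin_subst_times right_diff_distrib)
  finally show ?thesis by (simp add: SE_iff)
qed

text \<open>Third derivatives do not see the quadratic term, while \<partial> k \<partial> 0 gains
  W_{0,k} = R_{k+1}. This is the term left over when (TRR) for \<open>F\<close> is summed with the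
  chain rule coefficients.\<close>

lemma TRR_S_hat:
  assumes S: "reduced S" and F: "TRR F"
  shows "TRR (S_hat S F)"
  unfolding TRR_def
proof (intro allI)
  fix k l m
  let ?R = "inverse S"
  let ?D = "\<lambda>k F. \<Sum>i\<le>k. ips_const (fps_nth ?R (k - i)) * \<partial> i F"
  note G = reducedD(1)[OF S] and R = reducedD(2,3)[OF S]
  note Q = ips_deriv_deriv_quad[OF W_sym[OF G]]
  have dT: "\<partial> k (lin_subst ?R F) = lin_subst ?R (?D k F)" for k F
    by (simp add: ips_deriv_lin_subst)
  \<comment> \<open>The derivatives in \<open>l\<close> and \<open>m\<close> are moved inside the
    substitution; (TRR) is linear in them and so passes to \<open>H\<close>.\<close>
  define H where "H = ?D l (?D m F)"
  have H: "\<partial> (i + 1) H = \<partial> i (\<partial> 0 F) * \<partial> 0 H" for i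
  proof -
    have "\<partial> (i + 1) H = (\<Sum>a\<le>l. ips_const (fps_nth ?R (l - a)) * (\<Sum>b\<le>m. ips_const (fps_nth ?R (m - b)) *
            (\<partial> i (\<partial> 0 F) * \<partial> 0 (\<partial> a (\<partial> b F)))))"
      unfolding H_def using F by (simp add: TRR_def)
    also have "\<dots> = \<partial> i (\<partial> 0 F) * \<partial> 0 H"
      unfolding H_def by (simp add: sum_distrib_left mult.left_commute)
    finally show ?thesis .
  qed
  have "\<partial> (k + 1) (\<partial> l (\<partial> m (S_hat S F))) = lin_subst ?R (?D (k + 1) H)"
    by (simp only: S_hat_eq[OF S] ips_deriv_linear Q dT H_def add_0_right)
  \<comment> \<open>The summand \<partial> 0 H is split off, since (TRR) only rewrites derivatives
    of index \<open>i + 1\<close>.\<close>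
  also have "?D (k + 1) H = ips_const (fps_nth ?R (k + 1)) * \<partial> 0 H
      + (\<Sum>i\<le>k. ips_const (fps_nth ?R (k - i)) * \<partial> (i + 1) H)"
    by (simp only: Suc_eq_plus1[symmetric] sum.atMost_Suc_shift diff_Suc_Suc diff_zero)
  also have "\<dots> = (?D k (\<partial> 0 F) + ips_const (fps_nth ?R (k + 1))) * \<partial> 0 H"
    by (simp only: H) (simp add: sum_distrib_right ring_distribs mult.assoc)
  also have "lin_subst ?R \<dots> = (lin_subst ?R (?D k (\<partial> 0 F)) + ips_const (fps_nth ?R (k + 1))) * lin_subst ?R (\<partial> 0 H)"
    by (simp only: lin_subst_times lin_subst_add lin_subst_const)
  also have "lin_subst ?R (?D k (\<partial> 0 F)) + ips_const (fps_nth ?R (k + 1)) = \<partial> k (\<partial> 0 (S_hat S F))"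
  proof -
    have "\<partial> 0 (lin_subst ?R F) = lin_subst ?R (\<partial> 0 F)" using R by (simp add: ips_deriv_lin_subst)
    moreover have "W S 0 k = fps_nth ?R (k + 1)" using W_k_0[OF G, of k] W_sym[OF G, of 0 k] by simp
    ultimately show ?thesis by (simp only: S_hat_eq[OF S] ips_deriv_linear Q dT)
  qed
  also have "lin_subst ?R (\<partial> 0 H) = \<partial> 0 (\<partial> l (\<partial> m (S_hat S F)))"
  proof -
    have "\<partial> 0 (lin_subst ?R H) = lin_subst ?R (\<partial> 0 H)" using R by (simp add: ips_deriv_lin_subst)
    thus ?thesis by (simp only: S_hat_eq[OF S] ips_deriv_linear Q dT H_def add_0_right)
  qed
  finally show "\<partial> (k + 1) (\<partial> l (\<partial> m (S_hat S F)))
      = \<partial> k (\<partial> 0 (S_hat S F)) * \<partial> 0 (\<partial> l (\<partial> m (S_hat S F)))" .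
qed

lemma S_hat_in_GW0: "reduced S \<Longrightarrow> F \<in> GW0 \<Longrightarrow> S_hat S F \<in> GW0"
  by (simp add: GW0_def DE_S_hat SE_S_hat TRR_S_hat)

section \<open>Freeness and the group action\<close>

lemma S_hat_fixed_imp_one:
  assumes S: "reduced S" and fixed: "S_hat S F = F"
  shows "S = 1"
proof -
  let ?R = "inverse S" and ?c = "\<lambda>k. const_term (\<partial> k (\<partial> 0 F))"
  note G = reducedD(1)[OF S] and R = reducedD(2,3)[OF S]
  \<comment> \<open>This is \<partial> k \<partial> 0 of the fixed point equation at the origin;
    W_{0,k} supplies the last term.\<close>
  have c: "?c k = (\<Sum>i\<le>k. fps_nth ?R (k - i) * ?c i) + fps_nth ?R (Suc k)" for k
  proof -
    have "\<partial> k (\<partial> 0 (lin_subst ?R F + quad (W S)))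
        = (\<Sum>i\<le>k. ips_const (fps_nth ?R (k - i)) * lin_subst ?R (\<partial> i (\<partial> 0 F))) + ips_const (W S 0 k)"
      using R by (simp add: ips_deriv_lin_subst[of 0] ips_deriv_lin_subst[of k] ips_deriv_deriv_quad[OF W_sym[OF G]])
    hence "?c k = const_term ((\<Sum>i\<le>k. ips_const (fps_nth ?R (k - i)) * lin_subst ?R (\<partial> i (\<partial> 0 F))) + ips_const (W S 0 k))"
      using fixed by (simp only: S_hat_eq[OF S])
    thus ?thesis
      by (simp only: ips_nth_add ips_nth_const ips_nth_sum ips_nth_const_times const_term_lin_subst
          W_sym[OF G, of 0] W_k_0[OF G] simp_thms if_True)
  qed
  have "fps_nth ?R (Suc k) = 0" for k
  proof (induction k rule: less_induct)
    case (less k)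
    \<comment> \<open>By induction R_1, ..., R_k vanish, so only \<open>i = k\<close> survives and
      \<open>c\<close> forces R_{k+1} = 0.\<close>
    have "(\<Sum>i\<le>k. fps_nth ?R (k - i) * ?c i) = (\<Sum>i\<le>k. if i = k then ?c i else 0)"
    proof (intro sum.cong refl)
      fix i assume "i \<in> {..k}"
      hence "i = k \<or> (\<exists>j<k. k - i = Suc j)"
        by (metis Suc_diff_Suc atMost_iff diff_less_Suc le_neq_implies_less less_Suc_eq_le Suc_le_eq)
      thus "fps_nth ?R (k - i) * ?c i = (if i = k then ?c i else 0)"
        using less R(1) by auto
    qed
    thus ?case using c[of k] by simp
  qed
  hence "?R = 1" using R(1) by (intro fps_ext) (metis fps_one_nth not0_implies_Suc)
  thus "S = 1" using Gminus_mult_inverse[OF G] by simp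
qed

lemma bij_betw_S_hat:
  assumes "reduced S"
  shows "bij_betw (S_hat S) GW0 GW0"
proof -
  have inv: "inverse S * S = 1" by (rule Gminus_mult_inverse[OF reducedD(1)[OF assms]])
  note S' = reduced_inverse[OF assms]
  show ?thesis
    by (rule bij_betw_byWitness[where f' = "S_hat (inverse S)"])
       (auto simp: S_hat_mult assms S' inv mult.commute[of S] S_hat_one S_hat_in_GW0)
qed

text \<open>The restriction to \<open>GW0\<close> built into \<open>act\<close> provides the
  extensionality required by \<open>Bij\<close>.\<close>

lemma act_in_Bij: "C \<in> carrier Gminus' \<Longrightarrow> act C \<in> Bij GW0"
  by (simp add: Bij_def act_def bij_betw_S_hat reduced_rep)

lemma act_mult:
  assumes "C \<in> carrier Gminus'" "D \<in> carrier Gminus'"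
  shows "act (C \<otimes>\<^bsub>Gminus'\<^esub> D) = compose GW0 (act C) (act D)"
  using reduced_rep[OF assms(1)] reduced_rep[OF assms(2)]
  by (auto simp: act_def rep_mult[OF assms] compose_def S_hat_mult S_hat_in_GW0 fun_eq_iff)

theorem corollary4p1:
  shows "group_action Gminus' GW0 act \<and>
         (\<forall>F \<in> GW0. stabilizer Gminus' act F = {\<one>\<^bsub>Gminus'\<^esub>})"
proof (intro conjI ballI)
  interpret group Gminus' by (rule group_Gminus')
  have "act \<in> hom Gminus' (BijGroup GW0)"
    by (rule homI) (simp_all add: BijGroup_def act_in_Bij act_mult)
  thus "group_action Gminus' GW0 act"
    by (simp add: group_action_def group_hom_def group_hom_axioms_def group_BijGroup is_group)
  fix F assume F: "F \<in> GW0"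
  show "stabilizer Gminus' act F = {\<one>\<^bsub>Gminus'\<^esub>}"
  proof (intro equalityI subsetI)
    fix C assume "C \<in> stabilizer Gminus' act F"
    hence C: "C \<in> carrier Gminus'" "S_hat (rep C) F = F"
      using F by (auto simp: stabilizer_def act_def)
    hence "rep C = 1" using S_hat_fixed_imp_one reduced_rep by blast
    thus "C \<in> {\<one>\<^bsub>Gminus'\<^esub>}" using rep_eq_1D C(1) by blast
  next
    fix C assume "C \<in> {\<one>\<^bsub>Gminus'\<^esub>}"
    thus "C \<in> stabilizer Gminus' act F"
      using F by (simp add: stabilizer_def act_def rep_one S_hat_one)
  qed
qed

end
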